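(* Let $X$ be a real random variable with probability law $\mu$ on $\mathbb{R}$ and finite moments of every order, and suppose that the real polynomials are dense in $L^2(\mathbb{R},\mu)$. Let $q(x)=\delta x^2+\beta x+\gamma$ with real coefficients. (a) Suppose $X$ has a density $f$ such that $\int_{-\infty}^x(\mathbb{E}X-t)f(t)\,dt=q(x)f(x)$ for all $x\in\mathbb{R}$, and let $(r,s)=\{x:f(x)>0\}$. If $g\in L^2(\mathbb{R},\mu)$ is infinitely differentiable on $(r,s)$ and $\mathbb{E}[q^k(X)|g^{(k)}(X)|]<\infty$ for $k=0,1,2,\ldots$, then $$\operatorname{Var} g(X)=\sum_{k=1}^\infty\frac{\mathbb{E}^2\bigl[q^k(X)g^{(k)}(X)\bigr]}{k!\,\mathbb{E}[q^k(X)]\prod_{j=k-1}^{2k-2}(1-j\delta)}.$$ (b) Suppose $X$ is non-negative integer-valued with probability function $p$ such that $\sum_{j=0}^x(\mathbb{E}X-j)p(j)=q(x)p(x)$ for all $x=0,1,2,\ldots$, and that $\mu$ is not concentrated on a finite integer interval. If $g\in L^2(\mathbb{R},\mu)$ and $\mathbb{E}\bigl[q^{[k]}(X)|\Delta^k[g(X)]|\bigr]<\infty$ for $k=0,1,2,\ldots$, then $$\operatorname{Var} g(X)=\sum_{k=1}^\infty\frac{\mathbb{E}^2\bigl[q^{[k]}(X)\Delta^k[g(X)]\bigr]}{k!\,\mathbb{E}[q^{[k]}(X)]\prod_{j=k-1}^{2k-2}(1-j\delta)}.$$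
   Context: $q$ has degree at most 2 ($\delta,\beta$ may be zero); $q^k(x)=(q(x))^k$; $q^{[k]}(x)=q(x)q(x+1)\cdots q(x+k-1)$, $q^{[0]}\equiv1$; $\mathbb{E}^2[Y]=(\mathbb{E}[Y])^2$. $\Delta[g(x)]=g(x+1)-g(x)$, $\Delta^k=\Delta\circ\Delta^{k-1}$, $\Delta^0=\mathrm{id}$. In (a), the identity defining $q$ implies that (after possibly redefining $f$ at finite endpoints) $\{f>0\}$ is an open interval $(r,s)$, $-\infty\le r<s\le\infty$, with $q>0$ on it. In (b), the support $\{x\in\mathbb{Z}:p(x)>0\}$ is automatically an integer interval, here of the form $\{m,m+1,\ldots\}$. *)

theory Defs
  imports "HOL-Probability.Probability" "HOL-Computational_Algebra.Polynomial"
begin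

definition in_L2 :: "real measure \<Rightarrow> (real \<Rightarrow> real) \<Rightarrow> bool" where
  "in_L2 \<mu> g \<longleftrightarrow> g \<in> borel_measurable \<mu> \<and> integrable \<mu> (\<lambda>x. (g x)\<^sup>2)"

text \<open>In the presence of finite moments, as in the theorem, \<^term>\<open>poly P\<close> itself lies in
  \<open>L\<^sup>2(\<mu>)\<close>, so that the integral below is the genuine squared \<open>L\<^sup>2\<close> distance.\<close>

definition polynomials_dense_L2 :: "real measure \<Rightarrow> bool" where
  "polynomials_dense_L2 \<mu> \<longleftrightarrow>
     (\<forall>h. in_L2 \<mu> h \<longrightarrow>
       (\<forall>\<epsilon>>0. \<exists>P :: real poly. sqrt (\<integral>x. (h x - poly P x)\<^sup>2 \<partial>\<mu>) < \<epsilon>))"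

definition infinitely_differentiable_on :: "(real \<Rightarrow> real) \<Rightarrow> real set \<Rightarrow> bool" where
  "infinitely_differentiable_on g S \<longleftrightarrow>
     (\<forall>k. \<forall>x\<in>S. (deriv ^^ k) g differentiable (at x))"

text \<open>The \<open>k\<close>-th derivative on an open set \<open>S\<close>, extended by \<open>0\<close>.  Outside \<open>S\<close> no derivative
  need exist, and there \<^term>\<open>(deriv ^^ k) g\<close> could be an unspecified, even non-measurable,
  function.  The extension is immaterial for expectations when \<open>X \<in> S\<close> almost surely.\<close>

definition deriv_on :: "real set \<Rightarrow> nat \<Rightarrow> (real \<Rightarrow> real) \<Rightarrow> real \<Rightarrow> real" where
  "deriv_on S k g x = (if x \<in> S then (deriv ^^ k) g x else 0)"

definition forward_diff :: "(real \<Rightarrow> real) \<Rightarrow> real \<Rightarrow> real" where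
  "forward_diff g x = g (x + 1) - g x"

text \<open>\<open>q\<^bsup>[k]\<^esup>(x) = q(x) q(x+1) \<cdots> q(x+k-1)\<close>\<close>

definition ascending_power :: "(real \<Rightarrow> real) \<Rightarrow> nat \<Rightarrow> real \<Rightarrow> real" where
  "ascending_power q k x = (\<Prod>i<k. q (x + real i))"

end

theory Submission
  imports Defs
begin

text \<open>Write the cumulative identity as \<open>(q f)' = (m - x) f\<close>.  Then
  \<open>(q\<^bsup>i+1\<^esup> f Q)' = - q\<^sup>i f (T\<^sub>i Q)\<close> for every polynomial \<open>Q\<close>, where \<open>T\<^sub>i\<close> raises the degree by one and multiplies
  the leading coefficient (of degree \<open>d\<close>) by \<open>1 - (2 i + d) \<delta>\<close>.  Iterated integration by parts gives
  \<open>E[q\<^sup>k g\<^bsup>(k)\<^esup>] = E[P\<^sub>k g]\<close> with \<open>P\<^sub>k = T\<^sub>0 \<dots> T\<^bsub>k-1\<^esub> 1\<close>.  Taking polynomials for \<open>g\<close> shows that the \<open>P\<^sub>k\<close> are orthogonal,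
  and the series is Parseval's identity.

  Finite moments force \<open>\<delta> \<le> 0\<close>: otherwise \<open>q\<^sup>i f\<close> would be eventually monotone towards an
  infinite end for large \<open>i\<close>, hence not integrable.  The integrations by parts need no assumption beyond
  \<open>E[q\<^sup>k |g\<^bsup>(k)\<^esup>|] < \<infinity>\<close>: near an end \<open>q\<^bsup>i+1\<^esup> f (1 + |x|)\<^sup>d\<close> decreases at a rate
  comparable to \<open>q\<^sup>i f (1 + |x|)\<^bsup>d+1\<^esup>\<close>, so integrability of the derivative against the former weight
  gives integrability of the function against the latter; thus each step down in the order of the derivative gains
  a power of \<open>|x|\<close>.  The discrete case is the same with summation by parts.\<close>

section \<open>Expansion in polynomials dual to a family of weights\<close>

text \<open>The duality \<open>E[q^k R^(k)] = E[P_k R]\<close> does two jobs. For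
  \<open>degree R < k\<close> it is orthogonality; for \<open>degree R \<le> k\<close> the k-th
  derivative is the constant \<open>k! * coeff R k\<close>, so that
  \<open>E[P_k^2] = k! * E[q^k] * coeff P_k k\<close>. This is the denominator of the series: inside
  P_k the operator T_i meets degree k-1-i and contributes 1 - (2i + k-1-i) \<delta> = 1 - (i+k-1)
  \<delta>, and j = i+k-1 runs from k-1 to 2k-2. The sign of \<delta> keeps these factors positive;
  hence the P_k span all polynomials, and the weights decay at an infinite end. On a bounded
  interval the sign has another source: q vanishes at both ends and is positive between them. The
  obstacle is that g is controlled only through L1 norms, with no growth or boundary condition.
  Integrability of \<open>q^i f (1+|x|)^d g^(i)\<close> is drawn from order i+d, where no power of
  |x| is present, so even a single k uses the hypothesis at arbitrarily high orders. Finite and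
  infinite ends share one weight argument, and lower ends are reduced to upper ends by x ->
  -x.\<close>

lemma abs_poly_le:
  fixes p :: "real poly"
  assumes "degree p \<le> n"
  obtains C where "C \<ge> 0" "\<And>x. \<bar>poly p x\<bar> \<le> C * (1 + \<bar>x\<bar>) ^ n"
proof
  show "(\<Sum>i\<le>degree p. \<bar>coeff p i\<bar>) \<ge> 0" by (simp add: sum_nonneg)
  fix x :: real
  have "\<bar>poly p x\<bar> \<le> (\<Sum>i\<le>degree p. \<bar>coeff p i * x ^ i\<bar>)"
    unfolding poly_altdef by (rule sum_abs)
  also have "\<dots> \<le> (\<Sum>i\<le>degree p. \<bar>coeff p i\<bar> * (1 + \<bar>x\<bar>) ^ n)"
  proof (rule sum_mono)
    fix i assume "i \<in> {..degree p}"
    have "\<bar>x\<bar> ^ i \<le> (1 + \<bar>x\<bar>) ^ i" by (rule power_mono) auto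
    also have "\<dots> \<le> (1 + \<bar>x\<bar>) ^ n"
      using \<open>i \<in> _\<close> assms by (intro power_increasing) auto
    finally show "\<bar>coeff p i * x ^ i\<bar> \<le> \<bar>coeff p i\<bar> * (1 + \<bar>x\<bar>) ^ n"
      by (simp add: abs_mult power_abs mult_left_mono)
  qed
  finally show "\<bar>poly p x\<bar> \<le> (\<Sum>i\<le>degree p. \<bar>coeff p i\<bar>) * (1 + \<bar>x\<bar>) ^ n"
    by (simp add: sum_distrib_right)
qed

text \<open>Elimination from the top: subtracting a multiple of \<open>P n\<close> removes the
  coefficient of degree n and disturbs none above it. The bound on R is put on coefficients, not on
  the degree, so that n = 0 means R = 0 and can start the induction.\<close>

lemma poly_in_span_triangular:
  fixes P :: "nat \<Rightarrow> 'a::field poly"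
  assumes deg: "\<And>k. degree (P k) \<le> k" and lead: "\<And>k. coeff (P k) k \<noteq> 0"
    and "\<And>i. i \<ge> n \<Longrightarrow> coeff R i = 0"
  shows "\<exists>b. R = (\<Sum>k<n. smult (b k) (P k))"
  using assms(3)
proof (induction n arbitrary: R)
  case 0
  then show ?case by (simp add: poly_eq_iff)
next
  case (Suc n)
  define c where "c = coeff R n / coeff (P n) n"
  have "coeff (R - smult c (P n)) i = 0" if "i \<ge> n" for i
  proof (cases "i = n")
    case True
    then show ?thesis using lead[of n] by (simp add: c_def)
  next
    case False
    then have "coeff (P n) i = 0" using that deg[of n] by (intro coeff_eq_0) auto
    then show ?thesis using Suc.prems[of i] that False by simp
  qed
  from Suc.IH[OF this] obtain b where b: "R - smult c (P n) = (\<Sum>k<n. smult (b k) (P k))"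
    by blast
  have "(\<Sum>k<Suc n. smult ((b(n := c)) k) (P k)) = (\<Sum>k<n. smult (b k) (P k)) + smult c (P n)"
    by simp
  also have "\<dots> = R" by (simp flip: b)
  finally show ?case by metis
qed

lemma (in finite_measure) integrable_mult_L2:
  fixes f g :: "'a \<Rightarrow> real"
  assumes [measurable]: "f \<in> borel_measurable M" "g \<in> borel_measurable M"
    and "integrable M (\<lambda>x. (f x)\<^sup>2)" "integrable M (\<lambda>x. (g x)\<^sup>2)"
  shows "integrable M (\<lambda>x. f x * g x)"
proof (rule Bochner_Integration.integrable_bound)
  show "integrable M (\<lambda>x. (f x)\<^sup>2 + (g x)\<^sup>2)" using assms by auto
  have "\<bar>a * b\<bar> \<le> a\<^sup>2 + b\<^sup>2" for a b :: real
  proof -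
    have "2 * \<bar>a\<bar> * \<bar>b\<bar> \<le> a\<^sup>2 + b\<^sup>2"
      using sum_squares_bound[of "\<bar>a\<bar>" "\<bar>b\<bar>"] by simp
    moreover have "0 \<le> \<bar>a\<bar> * \<bar>b\<bar>" by simp
    ultimately show ?thesis unfolding abs_mult by linarith
  qed
  then show "AE x in M. norm (f x * g x) \<le> norm ((f x)\<^sup>2 + (g x)\<^sup>2)" by auto
qed measurable

lemma integrable_poly:
  fixes p :: "real poly"
  assumes "\<And>n. integrable M (\<lambda>x. h x ^ n :: real)"
  shows "integrable M (\<lambda>x. poly p (h x))"
  unfolding poly_altdef using assms by auto

text \<open>\<open>orth\<close> is a duality from which both orthogonality and the norms follow by
  taking R among the P j. The zeroth term of Parseval's identity is the squared mean; moving it to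
  the other side leaves the variance.\<close>

lemma parseval_polynomials:
  fixes \<mu> :: "real measure" and P :: "nat \<Rightarrow> real poly"
  assumes "prob_space \<mu>" and sets: "sets \<mu> = sets borel"
    and moments: "\<And>n. integrable \<mu> (\<lambda>x. x ^ n)"
    and dense: "polynomials_dense_L2 \<mu>"
    and deg: "\<And>k. degree (P k) \<le> k"
    and lead: "\<And>k. coeff (P k) k > 0"
    and K: "\<And>k. K k > 0"
    and orth: "\<And>k R. degree R \<le> k \<Longrightarrow> (\<integral>x. poly (P k) x * poly R x \<partial>\<mu>) = K k * coeff R k"
    and P0: "P 0 = 1"
    and g: "in_L2 \<mu> g"
  shows "(\<lambda>n. (\<integral>x. poly (P (Suc n)) x * g x \<partial>\<mu>)\<^sup>2 / (K (Suc n) * coeff (P (Suc n)) (Suc n)))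
           sums ((\<integral>x. (g x)\<^sup>2 \<partial>\<mu>) - (\<integral>x. g x \<partial>\<mu>)\<^sup>2)"
proof -
  interpret prob_space \<mu> by fact
  have [measurable]: "g \<in> borel_measurable \<mu>" and g2: "integrable \<mu> (\<lambda>x. (g x)\<^sup>2)"
    using g by (auto simp: in_L2_def)
  have [measurable]: "(\<lambda>x. poly p x) \<in> borel_measurable \<mu>" for p :: "real poly"
    unfolding measurable_cong_sets[OF sets refl]
    by (intro borel_measurable_continuous_onI continuous_intros)
  have ip: "integrable \<mu> (\<lambda>x. poly p x)" for p :: "real poly"
    using integrable_poly[of \<mu> "\<lambda>x. x"] moments by simp
  have ipp: "integrable \<mu> (\<lambda>x. poly p x * poly r x)" for p r :: "real poly"
    using ip[of "p * r"] by simp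
  have ig: "integrable \<mu> (\<lambda>x. poly p x * g x)" for p :: "real poly"
    using ipp[of p p] g2 by (intro integrable_mult_L2) (auto simp: power2_eq_square)
  define N where "N k = K k * coeff (P k) k" for k
  define e where "e k = (\<integral>x. poly (P k) x * g x \<partial>\<mu>)" for k
  have N: "N k > 0" for k using K lead by (simp add: N_def)
  \<comment> \<open>The polynomial of larger index is paired with the other one, whose coefficient
    at that index is 0; on the diagonal \<open>orth\<close> yields
    \<open>K k * coeff (P k) k\<close>.\<close>
  have orth': "(\<integral>x. poly (P j) x * poly (P k) x \<partial>\<mu>) = (if j = k then N k else 0)" for j k
  proof -
    have *: "(\<integral>x. poly (P k) x * poly (P j) x \<partial>\<mu>) = 0" if "j < k" for j k
      using orth[of "P j" k] deg[of j] that by (simp add: coeff_eq_0)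
    show ?thesis
      using *[of j k] *[of k j] orth[OF deg] by (cases j k rule: linorder_cases) (auto simp: N_def mult.commute)
  qed
  have dist: "(\<integral>x. (g x - poly (\<Sum>k<n. smult (b k) (P k)) x)\<^sup>2 \<partial>\<mu>)
      = (\<integral>x. (g x)\<^sup>2 \<partial>\<mu>) - 2 * (\<Sum>k<n. b k * e k) + (\<Sum>k<n. (b k)\<^sup>2 * N k)" for b n
  proof -
    let ?R = "\<Sum>k<n. smult (b k) (P k)"
    have "(\<integral>x. (g x - poly ?R x)\<^sup>2 \<partial>\<mu>)
       = (\<integral>x. (g x)\<^sup>2 - 2 * (poly ?R x * g x) + poly ?R x * poly ?R x \<partial>\<mu>)"
      by (intro Bochner_Integration.integral_cong) (auto simp: power2_eq_square algebra_simps)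
    also have "\<dots> = (\<integral>x. (g x)\<^sup>2 \<partial>\<mu>) - 2 * (\<integral>x. poly ?R x * g x \<partial>\<mu>) + (\<integral>x. poly ?R x * poly ?R x \<partial>\<mu>)"
      using ig[of ?R] ipp[of ?R ?R] g2 by simp
    also have "(\<integral>x. poly ?R x * g x \<partial>\<mu>) = (\<integral>x. (\<Sum>k<n. b k * (poly (P k) x * g x)) \<partial>\<mu>)"
      by (simp add: poly_sum sum_distrib_right mult.assoc)
    also have "\<dots> = (\<Sum>k<n. b k * e k)"
      using ig by (simp add: e_def)
    also have "(\<integral>x. poly ?R x * poly ?R x \<partial>\<mu>) =
       (\<integral>x. (\<Sum>j<n. \<Sum>k<n. b j * b k * (poly (P j) x * poly (P k) x)) \<partial>\<mu>)"
      by (simp add: poly_sum sum_product mult_ac)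
    also have "\<dots> = (\<Sum>j<n. \<Sum>k<n. b j * b k * (if j = k then N k else 0))"
      using ipp by (simp add: orth')
    also have "\<dots> = (\<Sum>j<n. (b j)\<^sup>2 * N j)"
      by (simp add: if_distrib[where f = "(*) _"] power2_eq_square cong: if_cong)
    finally show ?thesis .
  qed
  \<comment> \<open>The squared distance from g to the span of P 0, ..., P (n-1), attained at the
    Fourier coefficients \<open>e k / N k\<close>.\<close>
  define D where "D n = (\<integral>x. (g x)\<^sup>2 \<partial>\<mu>) - (\<Sum>k<n. (e k)\<^sup>2 / N k)" for n
  have D_eq: "D n = (\<integral>x. (g x - poly (\<Sum>k<n. smult (e k / N k) (P k)) x)\<^sup>2 \<partial>\<mu>)" for n
  proof -
    have "2 * (\<Sum>k<n. e k / N k * e k) - (\<Sum>k<n. (e k / N k)\<^sup>2 * N k) = (\<Sum>k<n. (e k)\<^sup>2 / N k)"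
      unfolding sum_distrib_left sum_subtractf[symmetric]
      by (rule sum.cong) (use N in \<open>auto simp: field_simps power2_eq_square dest: less_imp_neq\<close>)
    then show ?thesis unfolding dist D_def by linarith
  qed
  have D_nonneg: "D n \<ge> 0" for n
    unfolding D_eq by (rule integral_nonneg_AE) simp
  \<comment> \<open>Completing the square in each b k separately, as \<open>dist\<close> is a
    diagonal quadratic function of b.\<close>
  have D_le: "D n \<le> (\<integral>x. (g x - poly (\<Sum>k<n. smult (b k) (P k)) x)\<^sup>2 \<partial>\<mu>)" for n b
  proof -
    have "2 * (b k * e k) - (b k)\<^sup>2 * N k \<le> (e k)\<^sup>2 / N k" for k
    proof -
      have "0 \<le> (e k - b k * N k)\<^sup>2 / N k" using N[of k] by simp
      also have "\<dots> = (e k)\<^sup>2 / N k - (2 * (b k * e k) - (b k)\<^sup>2 * N k)"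
        using N[of k] by (simp add: field_simps power2_eq_square)
      finally show ?thesis by simp
    qed
    then have "(\<Sum>k<n. 2 * (b k * e k) - (b k)\<^sup>2 * N k) \<le> (\<Sum>k<n. (e k)\<^sup>2 / N k)"
      by (rule sum_mono)
    then show ?thesis unfolding dist D_def by (simp add: sum_subtractf sum_distrib_left)
  qed
  have D_anti: "D n \<le> D m" if "m \<le> n" for m n
  proof -
    have "(\<Sum>k<m. (e k)\<^sup>2 / N k) \<le> (\<Sum>k<n. (e k)\<^sup>2 / N k)"
      using that N by (intro sum_mono2) (auto intro: divide_nonneg_pos)
    then show ?thesis by (simp add: D_def)
  qed
  have "D \<longlonglongrightarrow> 0"
  proof (rule LIMSEQ_I)
    fix \<epsilon> :: real assume "\<epsilon> > 0"
    \<comment> \<open>Density speaks of the norm and D of its square, hence the tolerance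
      \<open>sqrt \<epsilon>\<close>.\<close>
    then have "sqrt \<epsilon> > 0" by simp
    with dense g obtain R :: "real poly" where R: "sqrt (\<integral>x. (g x - poly R x)\<^sup>2 \<partial>\<mu>) < sqrt \<epsilon>"
      unfolding polynomials_dense_L2_def by blast
    have "\<exists>b. R = (\<Sum>k<Suc (degree R). smult (b k) (P k))"
      by (rule poly_in_span_triangular)
         (use deg less_imp_neq[OF lead] in \<open>auto simp: coeff_eq_0 Suc_le_eq\<close>)
    then obtain b where b: "R = (\<Sum>k<Suc (degree R). smult (b k) (P k))" by blast
    have "D (Suc (degree R)) \<le> (\<integral>x. (g x - poly R x)\<^sup>2 \<partial>\<mu>)"
      using D_le[of "Suc (degree R)" b] unfolding b[symmetric] .
    with R have "D (Suc (degree R)) < \<epsilon>" by simp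
    then have "norm (D n - 0) < \<epsilon>" if "n \<ge> Suc (degree R)" for n
      using D_nonneg[of n] D_anti[OF that] by simp
    then show "\<exists>no. \<forall>n\<ge>no. norm (D n - 0) < \<epsilon>" by blast
  qed
  then have "(\<lambda>n. (\<integral>x. (g x)\<^sup>2 \<partial>\<mu>) - D n) \<longlonglongrightarrow> (\<integral>x. (g x)\<^sup>2 \<partial>\<mu>) - 0"
    by (intro tendsto_intros)
  then have "(\<lambda>k. (e k)\<^sup>2 / N k) sums (\<integral>x. (g x)\<^sup>2 \<partial>\<mu>)"
    by (simp add: sums_def D_def)
  moreover have "N 0 = 1" using orth'[of 0 0] by (simp add: P0 prob_space)
  moreover have "e 0 = (\<integral>x. g x \<partial>\<mu>)" by (simp add: e_def P0)
  ultimately show ?thesis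
    using sums_Suc_iff[of "\<lambda>k. (e k)\<^sup>2 / N k" "(\<integral>x. (g x)\<^sup>2 \<partial>\<mu>) - (\<integral>x. g x \<partial>\<mu>)\<^sup>2"]
    by (simp add: e_def N_def)
qed

text \<open>The composite T 0 (T 1 (... (T (i-1) Q))), highest index innermost: each integration by
  parts lowers by one both the power of q in the weight and the order of the derivative. For a
  density, \<open>lower T k 1\<close> is the Rodrigues polynomial (-1)^k (q^k f)^(k) / f.\<close>

primrec lower :: "(nat \<Rightarrow> real poly \<Rightarrow> real poly) \<Rightarrow> nat \<Rightarrow> real poly \<Rightarrow> real poly" where
  "lower T 0 Q = Q"
| "lower T (Suc i) Q = lower T i (T i Q)"

text \<open>T l is applied to degree d + i - 1 - l, and 2 l + (d + i - 1 - l) = l + (d + i) - 1.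
  Bounding the degree by d and tracking the coefficient at d, instead of the leading one, keeps the
  induction valid when that coefficient vanishes.\<close>

lemma lower_degree_coeff:
  assumes T: "\<And>l Q d. degree Q \<le> d \<Longrightarrow> degree (T l Q) \<le> Suc d \<and>
      coeff (T l Q) (Suc d) = (1 - real (2 * l + d) * \<delta>) * coeff Q d"
    and "degree Q \<le> d"
  shows "degree (lower T i Q) \<le> d + i \<and>
    coeff (lower T i Q) (d + i) = (\<Prod>l<i. 1 - real (l + (d + i) - 1) * \<delta>) * coeff Q d"
  using \<open>degree Q \<le> d\<close>
proof (induction i arbitrary: Q d)
  case 0
  then show ?case by simp
next
  case (Suc i)
  have "d + Suc i = Suc d + i" by simp
  \<comment> \<open>The factor from the innermost operator T i is the last factor, l = i, of the
    longer product.\<close>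
  moreover have "i + (Suc d + i) - 1 = 2 * i + d" by simp
  ultimately show ?case
    using Suc.IH[OF conjunct1[OF T[OF Suc.prems]], of i] conjunct2[OF T[OF Suc.prems], of i]
    by (simp only: lower.simps prod.lessThan_Suc mult.assoc simp_thms)
qed

lemma lower_one:
  assumes T: "\<And>l Q d. degree Q \<le> d \<Longrightarrow> degree (T l Q) \<le> Suc d \<and>
      coeff (T l Q) (Suc d) = (1 - real (2 * l + d) * \<delta>) * coeff Q d"
  shows "degree (lower T k 1) \<le> k"
    and "k > 0 \<Longrightarrow> coeff (lower T k 1) k = (\<Prod>j = k - 1..2 * k - 2. 1 - real j * \<delta>)"
proof -
  have *: "degree (lower T k 1) \<le> 0 + k \<and>
      coeff (lower T k 1) (0 + k) = (\<Prod>l<k. 1 - real (l + (0 + k) - 1) * \<delta>) * coeff 1 0"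
    by (rule lower_degree_coeff[OF T]) simp_all
  show "degree (lower T k 1) \<le> k" using * by simp
  have "coeff (lower T k 1) k = (\<Prod>l<k. 1 - real (l + k - 1) * \<delta>)" using * by simp
  also have "\<dots> = (\<Prod>j = k - 1..2 * k - 2. 1 - real j * \<delta>)" if "k > 0"
    by (rule prod.reindex_bij_witness[where i = "\<lambda>j. j - (k - 1)" and j = "\<lambda>l. l + k - 1"])
       (use that in auto)
  finally show "coeff (lower T k 1) k = (\<Prod>j = k - 1..2 * k - 2. 1 - real j * \<delta>)" if "k > 0"
    using that by blast
qed

text \<open>The common end of both parts: T, e and a are all that distinguishes the density from the
  probability function. Here e k stands for the mean of the k-th power of q, ordinary or ascending,
  and a k for the numerator before squaring, already rewritten by iterated parts.\<close>

lemma variance_series: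
  fixes M :: "'a measure" and X :: "'a \<Rightarrow> real" and \<delta> :: real
  assumes "prob_space M" and X [measurable]: "X \<in> borel_measurable M"
    and moments: "\<And>n :: nat. integrable M (\<lambda>\<omega>. X \<omega> ^ n)"
    and dense: "polynomials_dense_L2 (distr M borel X)"
    and T: "\<And>l Q d. degree Q \<le> d \<Longrightarrow> degree (T l Q) \<le> Suc d \<and>
      coeff (T l Q) (Suc d) = (1 - real (2 * l + d) * \<delta>) * coeff Q d"
    and \<delta>: "\<delta> \<le> 0"
    and e: "\<And>k. e k > 0"
    and orth: "\<And>k R. degree R \<le> k \<Longrightarrow>
      (\<integral>\<omega>. poly (lower T k 1) (X \<omega>) * poly R (X \<omega>) \<partial>M) = fact k * e k * coeff R k"
    and g: "in_L2 (distr M borel X) g"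
    and a: "\<And>k. a k = (\<integral>\<omega>. poly (lower T k 1) (X \<omega>) * g (X \<omega>) \<partial>M)"
  shows "(\<lambda>n. let k = Suc n in (a k)\<^sup>2 / (fact k * e k * (\<Prod>j = k - 1..2 * k - 2. 1 - real j * \<delta>)))
    sums prob_space.variance M (\<lambda>\<omega>. g (X \<omega>))"
proof -
  interpret prob_space M by fact
  let ?\<mu> = "distr M borel X" and ?P = "\<lambda>k. lower T k 1"
  interpret \<mu>: prob_space ?\<mu> by (rule prob_space_distr) simp
  have [measurable]: "g \<in> borel_measurable borel" and g2: "integrable ?\<mu> (\<lambda>x. (g x)\<^sup>2)"
    using g by (auto simp: in_L2_def)
  have [measurable]: "(\<lambda>x. poly p x) \<in> borel_measurable borel" for p :: "real poly"
    by (intro borel_measurable_continuous_onI continuous_intros)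
  have g2M: "integrable M (\<lambda>\<omega>. (g (X \<omega>))\<^sup>2)" using g2 by (simp add: integrable_distr_eq)
  have gM: "integrable M (\<lambda>\<omega>. g (X \<omega>))"
    by (rule square_integrable_imp_integrable[OF _ g2M]) simp
  have deg: "degree (?P k) \<le> k" for k by (rule lower_one(1)) (rule T)
  have lead_eq: "coeff (?P k) k = (\<Prod>j = k - 1..2 * k - 2. 1 - real j * \<delta>)" if "k > 0" for k
    by (rule lower_one(2)[OF _ that]) (rule T)
  have lead: "coeff (?P k) k > 0" for k
  proof (cases "k > 0")
    case True
    \<comment> \<open>With \<delta> nonpositive every factor is at least 1.\<close>
    have "1 - real j * \<delta> > 0" for j using \<delta> mult_nonneg_nonpos[of "real j" \<delta>] by simp
    then show ?thesis unfolding lead_eq[OF True] by (intro prod_pos) simp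
  qed simp
  have "(\<lambda>n. (\<integral>x. poly (?P (Suc n)) x * g x \<partial>?\<mu>)\<^sup>2
      / (fact (Suc n) * e (Suc n) * coeff (?P (Suc n)) (Suc n)))
    sums ((\<integral>x. (g x)\<^sup>2 \<partial>?\<mu>) - (\<integral>x. g x \<partial>?\<mu>)\<^sup>2)"
  proof (rule parseval_polynomials[OF \<mu>.prob_space_axioms _ _ dense deg lead _ _ _ g])
    show "integrable ?\<mu> (\<lambda>x. x ^ n)" for n using moments by (simp add: integrable_distr_eq)
    show "fact k * e k > 0" for k using e by simp
    show "(\<integral>x. poly (?P k) x * poly R x \<partial>?\<mu>) = fact k * e k * coeff R k" if "degree R \<le> k" for k R
      using orth[OF that] by (simp add: integral_distr)
  qed simp_all
  moreover have "(\<integral>x. (g x)\<^sup>2 \<partial>?\<mu>) - (\<integral>x. g x \<partial>?\<mu>)\<^sup>2 = variance (\<lambda>\<omega>. g (X \<omega>))"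
    by (simp add: integral_distr variance_eq gM g2M)
  moreover have "(\<integral>x. poly (?P k) x * g x \<partial>?\<mu>) = a k" for k
    by (simp add: integral_distr a)
  ultimately show ?thesis
    by (simp only: Let_def lead_eq[OF zero_less_Suc])
qed

section \<open>Boundary behaviour at the ends of an interval\<close>

text \<open>One filter on the reals for finite and infinite ends alike, so that boundary arguments
  need no case split. It is built from \<open>at_left s\<close> on extended reals because the
  fundamental theorem over (r,s) asks for limits in that form.\<close>

definition at_upper :: "ereal \<Rightarrow> real filter" where
  "at_upper s = filtermap real_of_ereal (at_left s)"

lemma at_upper_simps [simp]: "at_upper (ereal x) = at_left x" "at_upper \<infinity> = at_top"
  by (simp_all add: at_upper_def at_left_ereal at_left_PInf filtermap_filtermap filtermap_ident)

lemma tendsto_at_upper_iff: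
  "(h \<longlongrightarrow> l) (at_upper s) \<longleftrightarrow> ((h \<circ> real_of_ereal) \<longlongrightarrow> l) (at_left s)"
  by (simp add: at_upper_def tendsto_compose_filtermap)

text \<open>Turns the limit at the lower end, in the form required by the fundamental theorem, into
  a limit at the upper end of the reflected interval.\<close>

lemma tendsto_at_right_iff_at_upper_uminus:
  assumes "r \<noteq> \<infinity>"
  shows "((h \<circ> real_of_ereal) \<longlongrightarrow> l) (at_right r) \<longleftrightarrow> ((\<lambda>x. h (- x)) \<longlongrightarrow> l) (at_upper (- r))"
proof -
  have "filtermap real_of_ereal (at_right r) = filtermap uminus (at_upper (- r))"
    using assms
    by (cases r) (simp_all add: at_right_ereal at_right_MInf filtermap_filtermap filtermap_ident
        at_right_minus at_bot_mirror)
  then show ?thesis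
    unfolding tendsto_compose_filtermap by (simp add: filterlim_filtermap)
qed

lemma eventually_at_upper:
  assumes "r < s"
  shows "eventually P (at_upper s) \<longleftrightarrow> (\<exists>c\<in>einterval r s. \<forall>x. c < x \<and> ereal x < s \<longrightarrow> P x)"
proof
  assume "eventually P (at_upper s)"
  then obtain b where b: "b < s" "\<And>y. b < y \<Longrightarrow> y < s \<Longrightarrow> P (real_of_ereal y)"
    using eventually_at_left[OF assms] by (auto simp: at_upper_def eventually_filtermap)
  obtain c where "max r b < ereal c" "ereal c < s"
    using ereal_dense2[of "max r b" s] assms b(1) by auto
  then show "\<exists>c\<in>einterval r s. \<forall>x. c < x \<and> ereal x < s \<longrightarrow> P x"
    using b(2)[OF less_trans[of b "ereal c" "ereal _"]]
    by (intro bexI[of _ c]) (auto simp: einterval_iff)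
next
  assume "\<exists>c\<in>einterval r s. \<forall>x. c < x \<and> ereal x < s \<longrightarrow> P x"
  then obtain c where c: "r < ereal c" "ereal c < s" "\<And>x. c < x \<Longrightarrow> ereal x < s \<Longrightarrow> P x"
    by (auto simp: einterval_iff)
  have "P (real_of_ereal y)" if "ereal c < y" "y < s" for y
    using c(3)[of "real_of_ereal y"] that by (cases y) auto
  then show "eventually P (at_upper s)"
    unfolding at_upper_def eventually_filtermap
    using eventually_at_left[OF assms] c(2) by auto
qed

lemma at_upper_neq_bot: "r < s \<Longrightarrow> at_upper s \<noteq> bot"
  by (cases s) (auto simp: trivial_limit_at_left_real)

lemma eventually_at_upper_greater:
  "ereal c < s \<Longrightarrow> \<forall>\<^sub>F x in at_upper s. c < x \<and> ereal x < s"
  using eventually_at_upper[of "ereal c" s] ereal_dense2[of "ereal c" s]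
  by (fastforce simp: einterval_iff)

lemma set_borel_measurable_lborel:
  fixes \<phi> :: "real \<Rightarrow> real"
  assumes "A \<in> sets borel" "continuous_on A \<phi>"
  shows "set_borel_measurable lborel A \<phi>"
  using set_measurable_continuous_on[OF assms]
  by (simp only: set_borel_measurable_def measurable_lborel2)

text \<open>Monotone convergence along an exhaustion by compact intervals. It converts the uniform
  bounds on proper integrals, which the estimate below supplies, into integrability up to the end
  s.\<close>

lemma set_integrable_einterval_bounded:
  fixes \<phi> :: "real \<Rightarrow> real"
  assumes "ereal a < s"
    and cont: "continuous_on {x. a \<le> x \<and> ereal x < s} \<phi>"
    and nonneg: "\<And>x. a \<le> x \<Longrightarrow> ereal x < s \<Longrightarrow> 0 \<le> \<phi> x"
    and bound: "\<And>x. a \<le> x \<Longrightarrow> ereal x < s \<Longrightarrow> integral {a..x} \<phi> \<le> B"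
  shows "set_integrable lborel (einterval a s) \<phi>"
proof -
  obtain u l where approx: "einterval a s = (\<Union>i. {l i .. u i})"
    "incseq u" "decseq l" "\<And>i. l i < u i" "\<And>i. ereal a < ereal (l i)" "\<And>i. ereal (u i) < s"
    "(\<lambda>i. ereal (l i)) \<longlonglongrightarrow> ereal a" "(\<lambda>i. ereal (u i)) \<longlonglongrightarrow> s"
    by (rule einterval_Icc_approximation[OF assms(1)]) (rule that; assumption)
  have lt: "ereal x < s" if "x \<le> u i" for x i
    using le_less_trans[of "ereal x" "ereal (u i)" s] approx(6)[of i] that by simp
  have sub: "{l i..u i} \<subseteq> {x. a \<le> x \<and> ereal x < s}" for i
    using approx(5)[of i] lt by (force intro: less_imp_le)
  have int: "set_integrable lborel {l i..u i} \<phi>" for i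
    by (rule borel_integrable_atLeastAtMost') (rule continuous_on_subset[OF cont sub])
  define J where "J i = integral {l i..u i} \<phi>" for i
  have J: "(LBINT x=l i..u i. \<phi> x) = J i" for i
    using approx(4)[of i] int
    by (simp add: interval_integral_Icc less_imp_le set_borel_integral_eq_integral J_def)
  have iab: "\<phi> integrable_on {x..y}" if "a \<le> x" "ereal y < s" for x y
    by (rule integrable_continuous_interval, rule continuous_on_subset[OF cont])
       (use that le_less_trans[of "ereal _" "ereal y" s] in auto)
  have "incseq J"
    unfolding J_def incseq_def
  proof (intro allI impI integral_subset_le)
    fix m n :: nat assume "m \<le> n"
    then show "{l m..u m} \<subseteq> {l n..u n}" 
      using approx(2,3) by (auto simp: incseq_def decseq_def intro: order_trans)
    show "\<phi> integrable_on {l m..u m}" "\<phi> integrable_on {l n..u n}"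
      using approx(5)[of m] approx(5)[of n] by (auto intro!: iab approx(6))
    show "\<forall>x\<in>{l n..u n}. 0 \<le> \<phi> x"
      using sub[of n] by (blast intro: nonneg)
  qed
  moreover have "J i \<le> B" for i
  proof -
    have "J i \<le> integral {a..u i} \<phi>" unfolding J_def
      using approx(5)[of i] by (intro integral_subset_le iab ballI nonneg lt[of _ i] approx(6)) auto
    also have "\<dots> \<le> B" 
      using approx(4,5,6)[of i] by (intro bound) auto
    finally show ?thesis .
  qed
  ultimately obtain C where "J \<longlonglongrightarrow> C" using incseq_convergent by blast
  then have lim: "(\<lambda>i. LBINT x=l i..u i. \<phi> x) \<longlonglongrightarrow> C" by (simp add: J)
  have "continuous_on (einterval a s) \<phi>"
    by (rule continuous_on_subset[OF cont]) (auto simp: einterval_iff)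
  then have meas: "set_borel_measurable lborel (einterval a s) \<phi>"
    by (intro set_borel_measurable_lborel borel_einterval)
  show ?thesis
    by (rule interval_integral_Icc_approx_nonneg(1)[OF assms(1) approx int _ meas lim])
       (auto intro: nonneg less_imp_le)
qed

text \<open>The point is that \<open>H(x) = |h(c)| + \<integral>\<^sub>c\<^sup>x |h'|\<close> majorizes \<open>|h|\<close> and that
  \<open>\<integral>\<^sub>c\<^sup>x V |h| + W H - \<integral>\<^sub>c\<^sup>x W |h'|\<close> is decreasing.\<close>

lemma right_end_estimate:
  fixes W V h h' :: "real \<Rightarrow> real"
  assumes cs: "ereal c < s"
    and W: "\<And>x. c \<le> x \<Longrightarrow> ereal x < s \<Longrightarrow> (W has_real_derivative - V x) (at x)"
    and W_nonneg: "\<And>x. c \<le> x \<Longrightarrow> ereal x < s \<Longrightarrow> 0 \<le> W x"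
    and V_nonneg: "\<And>x. c \<le> x \<Longrightarrow> ereal x < s \<Longrightarrow> 0 \<le> V x"
    and V_cont: "continuous_on {x. c \<le> x \<and> ereal x < s} V"
    and h: "\<And>x. c \<le> x \<Longrightarrow> ereal x < s \<Longrightarrow> (h has_real_derivative h' x) (at x)"
    and h'_cont: "continuous_on {x. c \<le> x \<and> ereal x < s} h'"
    and bound: "\<And>x. c \<le> x \<Longrightarrow> ereal x < s \<Longrightarrow> integral {c..x} (\<lambda>x. W x * \<bar>h' x\<bar>) \<le> B"
  shows "\<And>x. c \<le> x \<Longrightarrow> ereal x < s \<Longrightarrow> integral {c..x} (\<lambda>x. V x * \<bar>h x\<bar>) \<le> W c * \<bar>h c\<bar> + B"
    and "(W \<longlongrightarrow> 0) (at_upper s) \<Longrightarrow> ((\<lambda>x. W x * h x) \<longlongrightarrow> 0) (at_upper s)"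
proof -
  let ?E = "{x. c \<le> x \<and> ereal x < s}"
  have W_cont: "continuous_on ?E W"
    by (rule continuous_at_imp_continuous_on) (auto intro: DERIV_isCont[OF W])
  have h_cont: "continuous_on ?E h"
    by (rule continuous_at_imp_continuous_on) (auto intro: DERIV_isCont[OF h])
  have sub: "{a..x} \<subseteq> ?E" if "c \<le> a" "ereal x < s" for a x
    using that by (auto intro: le_less_trans[of "ereal _" "ereal x" s])
  note cont = W_cont h_cont V_cont h'_cont
  have iW: "(\<lambda>x. W x * \<bar>h' x\<bar>) integrable_on {a..x}" if "c \<le> a" "ereal x < s" for a x
    by (intro integrable_continuous_interval continuous_intros cont[THEN continuous_on_subset] sub that)
  have ih: "(\<lambda>x. \<bar>h' x\<bar>) integrable_on {a..x}" if "c \<le> a" "ereal x < s" for a x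
    by (intro integrable_continuous_interval continuous_intros cont[THEN continuous_on_subset] sub that)
  have h_le: "\<bar>h x\<bar> \<le> \<bar>h a\<bar> + integral {a..x} (\<lambda>x. \<bar>h' x\<bar>)" if "c \<le> a" "a \<le> x" "ereal x < s" for a x
  proof -
    have "(h' has_integral (h x - h a)) {a..x}"
    proof (rule fundamental_theorem_of_calculus)
      fix y assume "y \<in> {a..x}"
      with sub[OF that(1,3)] have "c \<le> y" "ereal y < s" by auto
      then show "(h has_vector_derivative h' y) (at y within {a..x})"
        using h has_real_derivative_iff_has_vector_derivative has_vector_derivative_at_within by blast
    qed fact
    then have "\<bar>h x - h a\<bar> \<le> integral {a..x} (\<lambda>x. \<bar>h' x\<bar>)"
      using integral_norm_bound_integral[of h' "{a..x}" "\<lambda>x. \<bar>h' x\<bar>"] ih[OF that(1,3)]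
      by (auto simp: integral_unique integrable_on_def)
    then show ?thesis by linarith
  qed
  show "integral {c..x} (\<lambda>x. V x * \<bar>h x\<bar>) \<le> W c * \<bar>h c\<bar> + B" if x: "c \<le> x" "ereal x < s" for x
  proof -
    define H where "H y = \<bar>h c\<bar> + integral {c..y} (\<lambda>x. \<bar>h' x\<bar>)" for y
    define \<Phi> where "\<Phi> y = integral {c..y} (\<lambda>x. V x * \<bar>h x\<bar>) + W y * H y
                     - integral {c..y} (\<lambda>x. W x * \<bar>h' x\<bar>)" for y
    have yE: "c \<le> y" "ereal y < s" if "y \<in> {c..x}" for y
      using sub[OF order_refl x(2)] that by auto
    note cont' = cont[THEN continuous_on_subset, OF sub, OF order_refl x(2)]
    have D: "(\<Phi> has_real_derivative
       V y * \<bar>h y\<bar> + (- V y * H y + \<bar>h' y\<bar> * W y) - W y * \<bar>h' y\<bar>) (at y within {c..x})"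
      if y: "y \<in> {c..x}" for y
    proof -
      have "(H has_real_derivative 0 + \<bar>h' y\<bar>) (at y within {c..x})"
        unfolding H_def
        by (intro DERIV_add DERIV_const integral_has_real_derivative y continuous_intros cont')
      then have "(H has_real_derivative \<bar>h' y\<bar>) (at y within {c..x})" by simp
      then show ?thesis
        unfolding \<Phi>_def
        by (intro DERIV_add DERIV_diff DERIV_mult integral_has_real_derivative y continuous_intros cont'
             W[OF yE[OF y], THEN has_field_derivative_at_within])
    qed
    \<comment> \<open>In the derivative the two terms W |h'| cancel, leaving V (|h| - H), which is
      nonpositive as H majorizes |h|.\<close>
    have "\<Phi> x \<le> \<Phi> c"
    proof (rule DERIV_nonpos_imp_decreasing_open[OF x(1)])
      fix y assume y: "c < y" "y < x"
      have "at y within {c..x} = at y" using y by (rule at_within_Icc_at)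
      moreover have "\<bar>h y\<bar> \<le> H y"
        using h_le[of c y] y yE[of y] by (auto simp: H_def)
      moreover have "V y \<ge> 0" using y yE[of y] by (intro V_nonneg) auto
      ultimately show "\<exists>z. DERIV \<Phi> y :> z \<and> z \<le> 0"
        using D[of y] y by (auto simp: mult_left_mono)
    next
      show "continuous_on {c..x} \<Phi>"
        using D by (intro DERIV_continuous_on) blast
    qed
    moreover have "W x * H x \<ge> 0"
      using W_nonneg[OF x] by (simp add: H_def integral_nonneg[OF ih[OF _ x(2)]])
    ultimately show ?thesis using bound[OF x] by (simp add: \<Phi>_def H_def)
  qed
  have W_anti: "W y \<le> W x" if "c \<le> x" "x \<le> y" "ereal y < s" for x y
  proof (rule DERIV_nonpos_imp_nonincreasing[OF that(2)])
    fix z assume "x \<le> z" "z \<le> y"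
    then have "c \<le> z" "ereal z < s" using sub[of x y] that by auto
    then show "\<exists>v. DERIV W z :> v \<and> v \<le> 0" using W V_nonneg by fastforce
  qed
  assume lim: "(W \<longlongrightarrow> 0) (at_upper s)"
  show "((\<lambda>x. W x * h x) \<longlongrightarrow> 0) (at_upper s)"
  proof (rule tendstoI)
    fix e :: real assume "e > 0"
    let ?J = "\<lambda>x. integral {c..x} (\<lambda>x. W x * \<bar>h' x\<bar>)"
    have ne: "?E \<noteq> {}" using cs by auto
    have bdd: "bdd_above (?J ` ?E)" using bound by (auto intro!: bdd_aboveI[of _ B])
    \<comment> \<open>The point a is taken so far out that the integral of W |h'| beyond a stays
      below e / 2. As W decreases, \<open>W x\<close> times the integral of |h'| over [a,x] is no
      larger than this tail; the remaining term \<open>W x * \<bar>h a\<bar>\<close> tends to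
      0.\<close>
    have "Sup (?J ` ?E) - e / 2 < Sup (?J ` ?E)" using \<open>e > 0\<close> by simp
    then obtain a where a: "c \<le> a" "ereal a < s" "Sup (?J ` ?E) - e / 2 < ?J a"
      using less_cSUP_iff[OF ne bdd] by auto
    have small: "W x * integral {a..x} (\<lambda>x. \<bar>h' x\<bar>) < e / 2" if x: "a \<le> x" "ereal x < s" for x
    proof -
      have "W x * integral {a..x} (\<lambda>x. \<bar>h' x\<bar>) = integral {a..x} (\<lambda>y. W x * \<bar>h' y\<bar>)" by simp
      also have "\<dots> \<le> integral {a..x} (\<lambda>y. W y * \<bar>h' y\<bar>)"
        using a x by (intro integral_le iW integrable_on_mult_right ih mult_right_mono W_anti) auto
      also have "\<dots> = ?J x - ?J a"
        using Henstock_Kurzweil_Integration.integral_combine[OF a(1) x(1) iW[OF order_refl x(2)]] by simp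
      also have "?J x \<le> Sup (?J ` ?E)" using a x by (intro cSUP_upper bdd) auto
      finally show ?thesis using a(3) by simp
    qed
    have "((\<lambda>x. W x * \<bar>h a\<bar>) \<longlongrightarrow> 0 * \<bar>h a\<bar>) (at_upper s)" by (intro tendsto_intros lim)
    then have "\<forall>\<^sub>F x in at_upper s. W x * \<bar>h a\<bar> < e / 2"
      by (rule order_tendstoD(2)) (use \<open>e > 0\<close> in simp)
    with eventually_at_upper_greater[OF a(2)]
    show "\<forall>\<^sub>F x in at_upper s. dist (W x * h x) 0 < e"
    proof eventually_elim
      case (elim x)
      then have x: "a \<le> x" "ereal x < s" "0 \<le> W x" using a W_nonneg by auto
      have "W x * \<bar>h x\<bar> \<le> W x * (\<bar>h a\<bar> + integral {a..x} (\<lambda>x. \<bar>h' x\<bar>))"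
        using h_le[of a x] a x by (intro mult_left_mono) auto
      also have "\<dots> < e" using small[OF x(1,2)] elim by (simp add: distrib_left)
      finally show ?case using x by (simp add: abs_mult)
    qed
  qed
qed

section \<open>Continuous distributions of Pearson type\<close>

lemma poly_ge_at_top:
  fixes p :: "real poly"
  assumes "degree p \<le> n" "coeff p n > 0"
  obtains \<epsilon> where "\<epsilon> > 0" "\<forall>\<^sub>F x in at_top. poly p x \<ge> \<epsilon> * (1 + \<bar>x\<bar>) ^ n"
proof -
  have n: "degree p = n" using assms le_degree[of p n] by simp
  have "((\<lambda>x. poly p x / x ^ n) \<longlongrightarrow> coeff p n) at_top"
    using poly_divide_tendsto_aux[of p] n filterlim_at_infinity_imp_filterlim_at_top
    by (auto intro: filterlim_mono at_top_le_at_infinity)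
  then have "\<forall>\<^sub>F x in at_top. poly p x / x ^ n > coeff p n / 2"
    by (rule order_tendstoD) (use assms in simp)
  \<comment> \<open>Half of the leading coefficient is lost to the limit, and 2^n to 1 + x \<le> 2 x
    for x \<ge> 1.\<close>
  then have "\<forall>\<^sub>F x in at_top. poly p x \<ge> coeff p n / 2 / 2 ^ n * (1 + \<bar>x\<bar>) ^ n"
    using eventually_ge_at_top[of 1]
  proof eventually_elim
    case (elim x)
    have "(1 + \<bar>x\<bar>) ^ n \<le> (2 * x) ^ n" using elim by (intro power_mono) auto
    then have "coeff p n / 2 / 2 ^ n * (1 + \<bar>x\<bar>) ^ n \<le> coeff p n / 2 / 2 ^ n * (2 * x) ^ n"
      using assms by (intro mult_left_mono) auto
    also have "\<dots> = coeff p n / 2 * x ^ n" by (simp add: power_mult_distrib)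
    also have "\<dots> \<le> poly p x" using elim by (simp add: field_simps)
    finally show ?case .
  qed
  then show ?thesis using that[of "coeff p n / 2 / 2 ^ n"] assms by simp
qed

text \<open>The source of the factor k! in the denominators of part (a).\<close>

lemma higher_pderiv_eq_const:
  fixes R :: "real poly"
  assumes "degree R \<le> k"
  shows "(pderiv ^^ k) R = [:fact k * coeff R k:]"
  using assms
  by (intro poly_eqI)
     (auto simp: coeff_higher_pderiv coeff_pCons pochhammer_fact coeff_eq_0 split: nat.split)

lemma in_einterval_uminus_iff: "x \<in> einterval (- s) (- r) \<longleftrightarrow> - x \<in> einterval r s"
  by (auto simp: einterval_iff ereal_uminus_less_reorder ereal_less_uminus_reorder
      simp flip: uminus_ereal.simps(1))

lemma set_integrable_einterval_uminus:
  fixes \<phi> :: "real \<Rightarrow> real"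
  shows "set_integrable lborel (einterval r s) \<phi> \<longleftrightarrow>
    set_integrable lborel (einterval (- s) (- r)) (\<lambda>x. \<phi> (- x))"
proof -
  have "set_integrable lborel (einterval r s) \<phi> \<longleftrightarrow>
    integrable lborel (\<lambda>x. indicator (einterval r s) (0 + (- 1) * x) *\<^sub>R \<phi> (0 + (- 1) * x))"
    unfolding set_integrable_def by (rule lborel_integrable_real_affine_iff[symmetric]) simp
  then show ?thesis
    by (simp add: set_integrable_def indicator_def in_einterval_uminus_iff)
qed

lemma quadratic_poly_eq:
  assumes "degree q \<le> 2"
  shows "q = [:coeff q 0, coeff q 1, coeff q 2:]"
  using assms
  by (intro poly_eqI) (auto simp: coeff_pCons eval_nat_numeral coeff_eq_0 split: nat.split)

text \<open>The integral identity in differential form, with vanishing of q f at both ends as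
  boundary data. The lower limit is written as an upper limit of the reflected function, so that the
  axioms are symmetric under x -> -x.\<close>

locale pearson =
  fixes f :: "real \<Rightarrow> real" and m :: real and q :: "real poly" and r s :: ereal
  assumes r_less_s: "r < s"
    and degree_q: "degree q \<le> 2"
    and f_pos: "x \<in> einterval r s \<Longrightarrow> f x > 0"
    and q_pos: "x \<in> einterval r s \<Longrightarrow> poly q x > 0"
    and qf_deriv: "x \<in> einterval r s \<Longrightarrow>
      ((\<lambda>x. poly q x * f x) has_real_derivative (m - x) * f x) (at x)"
    and qf_upper: "((\<lambda>x. poly q x * f x) \<longlongrightarrow> 0) (at_upper s)"
    and qf_lower: "((\<lambda>x. poly q (- x) * f (- x)) \<longlongrightarrow> 0) (at_upper (- r))"
    and moments: "set_integrable lborel (einterval r s) (\<lambda>x. f x * x ^ n)"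
begin

text \<open>Replacing X by -X preserves the class and the coefficient of x^2 in q; facts about lower
  ends are thus obtained from those about upper ends.\<close>

lemma reflect: "pearson (\<lambda>x. f (- x)) (- m) (pcompose q [:0, -1:]) (- s) (- r)"
proof
  note E = in_einterval_uminus_iff
  show "- s < - r" using r_less_s by simp
  show "degree (pcompose q [:0, -1:]) \<le> 2" using degree_q by (simp add: degree_pcompose)
  show "f (- x) > 0" if "x \<in> einterval (- s) (- r)" for x using f_pos that E by simp
  show "poly (pcompose q [:0, -1:]) x > 0" if "x \<in> einterval (- s) (- r)" for x
    using q_pos that E by (simp add: poly_pcompose)
  show "((\<lambda>x. poly (pcompose q [:0, -1:]) x * f (- x)) has_real_derivative (- m - x) * f (- x)) (at x)"
    if "x \<in> einterval (- s) (- r)" for x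
    using DERIV_mirror[THEN iffD1, OF qf_deriv[of "- x"]] that E
    by (simp add: poly_pcompose algebra_simps)
  show "((\<lambda>x. poly (pcompose q [:0, -1:]) x * f (- x)) \<longlongrightarrow> 0) (at_upper (- r))"
    using qf_lower by (simp add: poly_pcompose)
  show "((\<lambda>x. poly (pcompose q [:0, -1:]) (- x) * f (- (- x))) \<longlongrightarrow> 0) (at_upper (- (- s)))"
    using qf_upper by (simp add: poly_pcompose)
  fix n :: nat
  have "set_integrable lborel (einterval r s) (\<lambda>x. (- 1) ^ n * (f x * x ^ n))"
    by (intro set_integrable_mult_right moments)
  then show "set_integrable lborel (einterval (- s) (- r)) (\<lambda>x. f (- x) * x ^ n)"
    using set_integrable_einterval_uminus[of r s "\<lambda>x. (- 1) ^ n * (f x * x ^ n)"]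
    by (simp add: mult.left_commute flip: power_mult_distrib)
qed

text \<open>Read off from the product rule for (q f) (q^i Q), where \<open>[:m, - 1:]\<close> is m -
  x. The sign is chosen to make the top factor 1 - (2 i + d) \<delta>.\<close>

definition T :: "nat \<Rightarrow> real poly \<Rightarrow> real poly" where
  "T i Q = - (smult (real i) (pderiv q) + [:m, - 1:]) * Q - q * pderiv Q"

text \<open>At the top degree x Q contributes 1, i q' Q contributes -2 i \<delta> and q Q'
  contributes -d \<delta>, each times the coefficient of Q at d.\<close>

lemma T_degree_coeff:
  assumes "degree Q \<le> d"
  shows "degree (T i Q) \<le> Suc d \<and>
    coeff (T i Q) (Suc d) = (1 - real (2 * i + d) * coeff q 2) * coeff Q d"
proof -
  define a b c where abc: "a = coeff q 0" "b = coeff q 1" "c = coeff q 2"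
  have q: "q = [:a, b, c:]"
    unfolding abc by (rule quadratic_poly_eq[OF degree_q])
  have T: "T i Q = - (smult (real i) (pderiv [:a, b, c:]) + [:m, - 1:]) * Q - [:a, b, c:] * pderiv Q"
    by (simp only: T_def q[symmetric])
  have *: "coeff (T i Q) (Suc n) = (1 - real i * 2 * c) * coeff Q n - (real i * b + m) * coeff Q (Suc n)
     - a * real (Suc (Suc n)) * coeff Q (Suc (Suc n)) - b * real (Suc n) * coeff Q (Suc n) - c * real n * coeff Q n" for n
    by (cases n) (simp_all add: T coeff_pderiv pderiv_pCons algebra_simps)
  have "degree (T i Q) \<le> Suc d"
  proof (rule degree_le, intro allI impI)
    fix n assume "n > Suc d"
    then obtain k where "n = Suc k" "k > d" by (cases n) auto
    then show "coeff (T i Q) n = 0" using assms * by (simp add: coeff_eq_0)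
  qed
  moreover have "coeff (T i Q) (Suc d) = (1 - real (2 * i + d) * c) * coeff Q d"
    using assms by (simp add: * coeff_eq_0 algebra_simps)
  ultimately show ?thesis by (simp add: abc)
qed

text \<open>The factors are grouped as (q f) (q^i Q), because the locale provides a derivative for q
  f and not for f.\<close>

lemma weight_deriv:
  assumes "x \<in> einterval r s"
  shows "((\<lambda>x. poly q x ^ Suc i * f x * poly Q x) has_real_derivative
           - (poly q x ^ i * f x * poly (T i Q) x)) (at x)"
proof -
  have "((\<lambda>x. (poly q x * f x) * (poly q x ^ i * poly Q x)) has_real_derivative
     ((m - x) * f x) * (poly q x ^ i * poly Q x)
     + (of_nat i * (poly (pderiv q) x * poly q x ^ (i - Suc 0)) * poly Q x
        + poly (pderiv Q) x * poly q x ^ i) * (poly q x * f x)) (at x)"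
    by (intro DERIV_mult qf_deriv[OF assms] DERIV_power poly_DERIV)
  then show ?thesis
    by (cases i) (simp_all add: T_def algebra_simps)
qed

lemma f_isCont:
  assumes "x \<in> einterval r s"
  shows "isCont f x"
proof -
  have "isCont (\<lambda>x. poly q x * f x / poly q x) x"
    using q_pos[OF assms]
    by (intro isCont_divide DERIV_isCont[OF qf_deriv[OF assms]] poly_isCont) simp
  moreover have "\<forall>\<^sub>F y in nhds x. poly q y * f y / poly q y = f y"
    using eventually_nhds_in_open[OF open_einterval assms]
    by eventually_elim (use q_pos in force)
  ultimately show ?thesis using isCont_cong[of "\<lambda>x. poly q x * f x / poly q x" f x] by blast
qed

lemma f_continuous: "continuous_on (einterval r s) f"
  by (simp add: continuous_at_imp_continuous_on f_isCont)

lemma eventually_in: "\<forall>\<^sub>F x in at_upper s. x \<in> einterval r s"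
proof -
  obtain c where "r < ereal c" "ereal c < s" using ereal_dense2[OF r_less_s] by auto
  with eventually_at_upper_greater[of c s] show ?thesis
    by (auto simp: einterval_iff elim!: eventually_mono intro: less_trans[of r "ereal c"])
qed

lemma between:
  assumes "c \<in> einterval r s" "c \<le> y" "y \<le> x" "ereal x < s"
  shows "y \<in> einterval r s"
  using assms by (metis einterval_iff ereal_less_eq(3) le_less_trans less_le_trans)

text \<open>Otherwise (q f)' = (m - x) f would be positive throughout, and the positive increasing
  function q f could not tend to 0 at s. This provides S - m > 0 when weights at a finite end S are
  sought.\<close>

lemma mean_less_upper: "ereal m < s"
proof (rule ccontr)
  assume "\<not> ereal m < s"
  then have less: "x < m" if "x \<in> einterval r s" for x
    using that by (auto simp: einterval_iff not_less dest: less_le_trans)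
  obtain c where c: "c \<in> einterval r s" using einterval_nonempty[OF r_less_s] by blast
  let ?W = "\<lambda>x. poly q x * f x"
  have "?W c \<le> ?W x" if "c < x" "ereal x < s" for x
  proof (rule DERIV_nonneg_imp_nondecreasing[where f = ?W])
    fix y assume "c \<le> y" "y \<le> x"
    then have "y \<in> einterval r s"
      by (rule between[OF c _ _ that(2)])
    then show "\<exists>z. DERIV ?W y :> z \<and> 0 \<le> z"
      using qf_deriv less[of y] f_pos[of y] by (intro exI conjI) auto
  qed (use that in simp)
  then have "\<forall>\<^sub>F x in at_upper s. ?W c \<le> ?W x"
    using eventually_at_upper[OF r_less_s] c by blast
  then have "?W c \<le> 0"
    using tendsto_lowerbound[OF qf_upper _ at_upper_neq_bot[OF r_less_s]] by blast
  then show False using q_pos[OF c] f_pos[OF c] by (simp add: mult_le_0_iff)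
qed

text \<open>Otherwise \<open>(q f)' / (q f) = (m - x) / q\<close> would be bounded near \<open>S\<close>, and \<open>q f\<close> could not
  tend to \<open>0\<close> there.\<close>

lemma q_upper_eq_0:
  assumes "s = ereal S"
  shows "poly q S = 0"
proof (rule ccontr)
  assume "poly q S \<noteq> 0"
  have lim_q: "(poly q \<longlongrightarrow> poly q S) (at_left S)"
    by (intro tendsto_poly tendsto_ident_at)
  have "\<forall>\<^sub>F x in at_upper s. 0 \<le> poly q x"
    using eventually_in by eventually_elim (simp add: q_pos less_imp_le)
  then have "\<forall>\<^sub>F x in at_left S. 0 \<le> poly q x" by (simp add: assms)
  then have "0 \<le> poly q S" by (intro tendsto_lowerbound[OF lim_q]) auto
  with \<open>poly q S \<noteq> 0\<close> have pos: "poly q S > 0" by simp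
  have "((\<lambda>x. (m - x) / poly q x) \<longlongrightarrow> (m - S) / poly q S) (at_left S)"
    using \<open>poly q S \<noteq> 0\<close> by (intro tendsto_intros lim_q)
  \<comment> \<open>The logarithmic derivative of q f tends to (m - S) / q(S) = 1 - C, so it exceeds
    -C near S. Multiplication by exp (C x) therefore makes q f nondecreasing there without changing
    its limit 0.\<close>
  define C where "C = 1 - (m - S) / poly q S"
  have "\<forall>\<^sub>F x in at_left S. (m - x) / poly q x > - C"
    by (rule order_tendstoD) (fact, simp add: C_def)
  then have "\<forall>\<^sub>F x in at_upper s. x \<in> einterval r s \<and> (m - x) / poly q x > - C"
    using eventually_in assms by (auto intro: eventually_conj)
  then obtain c where c: "c \<in> einterval r s"
    and cx: "\<And>x. c < x \<Longrightarrow> ereal x < s \<Longrightarrow> x \<in> einterval r s \<and> (m - x) / poly q x > - C"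
    using eventually_at_upper[OF r_less_s] by (metis (mono_tags, lifting))
  obtain d where d: "c < d" "ereal d < s"
    using c ereal_dense2[of "ereal c" s] by (auto simp: einterval_iff)
  let ?W = "\<lambda>x. poly q x * f x * exp (C * x)"
  have "?W d \<le> ?W x" if "d < x" "ereal x < s" for x
  proof (rule DERIV_nonneg_imp_nondecreasing[where f = ?W])
    fix y assume "d \<le> y" "y \<le> x"
    then have y: "c < y" "ereal y < s"
      using d that between[OF c, of y x] by (auto simp: einterval_iff)
    note y' = cx[OF y]
    then have "- C * poly q y \<le> m - y" using q_pos[of y] by (simp add: field_simps)
    then have "0 \<le> ((m - y) + C * poly q y) * f y * exp (C * y)"
      using f_pos[of y] y' by simp
    moreover have "DERIV ?W y :> ((m - y) + C * poly q y) * f y * exp (C * y)"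
      by (rule DERIV_mult[OF qf_deriv DERIV_fun_exp[OF DERIV_cmult_Id], THEN DERIV_cong])
         (use y' in \<open>auto simp: algebra_simps\<close>)
    ultimately show "\<exists>z. DERIV ?W y :> z \<and> 0 \<le> z" by blast
  qed (use that in simp)
  then have "\<forall>\<^sub>F x in at_upper s. ?W d \<le> ?W x"
    using eventually_at_upper_greater[OF d(2)] by (auto elim: eventually_mono)
  moreover have "(?W \<longlongrightarrow> 0 * exp (C * S)) (at_upper s)"
    using qf_upper unfolding assms at_upper_simps by (intro tendsto_intros)
  ultimately have "?W d \<le> 0"
    using tendsto_lowerbound[OF _ _ at_upper_neq_bot[OF r_less_s]] by fastforce
  moreover have "?W d > 0" using q_pos f_pos cx[OF d] by simp
  ultimately show False by simp
qed

lemma integrable_f_poly: "set_integrable lborel (einterval r s) (\<lambda>x. f x * poly Q x)"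
proof -
  have "set_integrable lborel (einterval r s) (\<lambda>x. \<Sum>i\<le>degree Q. coeff Q i * (f x * x ^ i))"
    unfolding set_integrable_def scaleR_sum_right
    by (intro Bochner_Integration.integrable_sum
        set_integrable_mult_right[unfolded set_integrable_def] moments[unfolded set_integrable_def])
  then show ?thesis by (simp add: poly_altdef sum_distrib_left mult_ac)
qed

lemma lead_nonpos_if_unbounded:
  assumes "s = \<infinity>"
  shows "coeff q 2 \<le> 0"
proof (rule ccontr)
  assume pos: "\<not> coeff q 2 \<le> 0"
  \<comment> \<open>With i \<delta> > 1 the coefficient 1 - 2 i \<delta> of x in
    \<open>T i 1\<close> is negative, so q^(i+1) f eventually increases.\<close>
  then obtain i :: nat where "1 / coeff q 2 < real i" using reals_Archimedean2 by blast
  then have i: "1 < real i * coeff q 2" using pos by (simp add: field_simps)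
  have "degree (- T i 1) \<le> 1" "coeff (- T i 1) 1 > 0"
    using T_degree_coeff[of 1 0 i] i by auto
  then obtain \<epsilon> where "\<epsilon> > 0" "\<forall>\<^sub>F x in at_top. poly (- T i 1) x \<ge> \<epsilon> * (1 + \<bar>x\<bar>) ^ 1"
    by (rule poly_ge_at_top)
  then have "\<forall>\<^sub>F x in at_upper s. poly (- T i 1) x \<ge> \<epsilon> * (1 + \<bar>x\<bar>) ^ 1"
    using assms by simp
  then have "\<forall>\<^sub>F x in at_upper s. poly (T i 1) x \<le> 0 \<and> x \<in> einterval r s"
    using eventually_in
  proof eventually_elim
    case (elim x)
    moreover have "\<epsilon> * (1 + \<bar>x\<bar>) ^ 1 \<ge> 0" using \<open>\<epsilon> > 0\<close> by simp
    ultimately show ?case by simp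
  qed
  then obtain c where c: "c \<in> einterval r s"
    and cx: "\<And>x. c < x \<Longrightarrow> poly (T i 1) x \<le> 0 \<and> x \<in> einterval r s"
    using eventually_at_upper[OF r_less_s] assms by (auto simp: einterval_iff)
  define W where "W x = poly q x ^ Suc i * f x" for x
  define d where "d = c + 1"
  have mono: "W d \<le> W x" if "d \<le> x" for x
  proof (rule DERIV_nonneg_imp_nondecreasing[OF that])
    fix y assume "d \<le> y"
    then have y: "y \<in> einterval r s" "poly (T i 1) y \<le> 0" using cx[of y] by (auto simp: d_def)
    then have "0 \<le> - (poly q y ^ i * f y * poly (T i 1) y)"
      using q_pos[of y] f_pos[of y] by (simp add: mult_nonneg_nonpos)
    then show "\<exists>z. DERIV W y :> z \<and> 0 \<le> z"
      using weight_deriv[OF y(1), of i 1] unfolding W_def by auto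
  qed
  have Wd: "W d > 0" using cx[of d] q_pos f_pos by (simp add: W_def d_def)
  have "set_integrable lborel (einterval r s) W"
    using integrable_f_poly[of "q ^ Suc i"] by (simp add: W_def[abs_def] mult_ac)
  then have int: "set_integrable lborel {d..} W"
    by (rule set_integrable_subset) (use cx d_def in auto)
  have "set_integrable lborel {d..} (\<lambda>x. W d)"
    by (rule set_integrable_bound[OF int])
       (use mono Wd in \<open>auto simp: set_borel_measurable_def intro!: AE_I2 order.trans[OF _ abs_ge_self]\<close>)
  then have "integrable lborel (\<lambda>x. indicator {d..} x :: real)"
    using Wd by (simp add: set_integrable_def)
  then have fin: "emeasure lborel {d..} < \<infinity>" by (simp add: integrable_indicator_iff)
  have "ennreal (real n) \<le> emeasure lborel {d..}" for n :: nat
  proof -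
    have "emeasure lborel {d..d + real n} \<le> emeasure lborel {d..}" by (intro emeasure_mono) auto
    then show ?thesis by simp
  qed
  moreover obtain n :: nat where "emeasure lborel {d..} < of_nat n"
    using fin ennreal_Ex_less_of_nat by (auto simp: infinity_ennreal_def)
  ultimately show False by (auto simp: ennreal_of_nat_eq_real_of_nat not_less[symmetric])
qed

text \<open>An infinite end is excluded for positive \<delta> by integrability, after reflection if
  it is the lower one. On a bounded interval q vanishes at both ends and is positive at the
  midpoint, which forces concavity.\<close>

lemma lead_nonpos: "coeff q 2 \<le> 0"
proof -
  interpret R: pearson "\<lambda>x. f (- x)" "- m" "pcompose q [:0, -1:]" "- s" "- r" by (rule reflect)
  define a b c where abc: "a = coeff q 0" "b = coeff q 1" "c = coeff q 2"
  have q: "q = [:a, b, c:]"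
    unfolding abc by (rule quadratic_poly_eq[OF degree_q])
  show ?thesis
  proof (cases s)
    case [simp]: (real S)
    show ?thesis
    proof (cases r)
      case [simp]: (real R)
      have "R < S" using r_less_s by simp
      have "poly q S = 0" using q_upper_eq_0[OF \<open>s = _\<close>] .
      moreover have "poly q R = 0" using R.q_upper_eq_0[of "- R"] by (simp add: poly_pcompose)
      moreover have "poly q ((R + S) / 2) > 0"
        using \<open>R < S\<close> by (intro q_pos) (auto simp: einterval_iff)
      \<comment> \<open>For a quadratic, the gap between midpoint value and mean of the end values
        is exactly -\<delta> (S - R)^2 / 4.\<close>
      moreover have "poly q ((R + S) / 2) = (poly q R + poly q S) / 2 - c * (S - R)\<^sup>2 / 4"
        by (simp add: q power2_eq_square field_simps)
      ultimately have "c * (S - R)\<^sup>2 < 0" by simp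
      then show ?thesis by (simp add: mult_less_0_iff abc)
    next
      case MInf
      then have "coeff (pcompose q [:0, -1:]) 2 \<le> 0" using R.lead_nonpos_if_unbounded by simp
      moreover have "coeff (pcompose [:a, b, c:] [:0, -1:]) 2 = c"
        by (simp add: pcompose_pCons eval_nat_numeral)
      ultimately show ?thesis by (simp only: q[symmetric] abc(3)[symmetric])
    qed (use r_less_s in auto)
  qed (use r_less_s lead_nonpos_if_unbounded in auto)
qed

text \<open>The weight \<open>R\<close> is \<open>1\<close> at a finite end and \<open>x\<^sup>d\<close> at an infinite one.\<close>

lemma weight_exists:
  obtains R K \<epsilon> where "K > 0" "\<epsilon> > 0"
    "\<forall>\<^sub>F x in at_upper s. poly R x > 0 \<and> (1 + \<bar>x\<bar>) ^ d \<le> K * poly R x \<and>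
       poly R x \<le> K * (1 + \<bar>x\<bar>) ^ d \<and> \<epsilon> * (1 + \<bar>x\<bar>) ^ Suc d \<le> poly (T i R) x"
    "((\<lambda>x. poly q x ^ Suc i * f x * poly R x) \<longlongrightarrow> 0) (at_upper s)"
proof (cases s)
  case (real S)
  have q0: "poly q S = 0" using q_upper_eq_0[OF real] .
  \<comment> \<open>A positive slope at the zero S would make q negative just to the left of
    S.\<close>
  have "poly (pderiv q) S \<le> 0"
  proof (rule ccontr)
    assume "\<not> poly (pderiv q) S \<le> 0"
    then obtain e where e: "e > 0" "\<And>h. h > 0 \<Longrightarrow> h < e \<Longrightarrow> poly q (S - h) < 0"
      using DERIV_pos_inc_left[OF poly_DERIV[of q S]] q0 by auto
    have "\<forall>\<^sub>F x in at_left S. x \<in> {S - e<..<S}"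
      using e(1) by (intro eventually_at_left_real) simp
    then have "\<forall>\<^sub>F x in at_upper s. x \<in> {S - e<..<S}" by (simp add: real)
    with eventually_in have "\<forall>\<^sub>F x in at_upper s. False"
    proof eventually_elim
      case (elim x)
      then show ?case using e(2)[of "S - x"] q_pos[of x] by simp
    qed
    then show False using at_upper_neq_bot[OF r_less_s] by simp
  qed
  moreover have "m < S" using mean_less_upper real by simp
  \<comment> \<open>This is positivity of \<open>T i 1\<close> at S, whose value there is S - m - i
    q'(S) because the constant 1 has no derivative term.\<close>
  ultimately have "real i * poly (pderiv q) S + m < S"
    using mult_nonneg_nonpos[of "real i" "poly (pderiv q) S"] by simp
  then have L: "poly (T i 1) S > 0" by (simp add: T_def)
  define L where "L = poly (T i 1) S"
  \<comment> \<open>A strict upper bound for (1 + |x|)^(d+1) near S that is also at least 1, so that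
    the constant weight compares with (1 + |x|)^d in both directions.\<close>
  define B where "B = (1 + \<bar>S\<bar>) ^ Suc d + 1"
  have B: "B \<ge> 1" by (simp add: B_def)
  have "((\<lambda>x. (1 + \<bar>x\<bar>) ^ Suc d) \<longlongrightarrow> (1 + \<bar>S\<bar>) ^ Suc d) (at_left S)"
    by (intro tendsto_intros)
  then have ev1: "\<forall>\<^sub>F x in at_left S. (1 + \<bar>x\<bar>) ^ Suc d < B"
    by (rule order_tendstoD) (simp add: B_def)
  have "((\<lambda>x. poly (T i 1) x) \<longlongrightarrow> L) (at_left S)"
    unfolding L_def by (intro tendsto_poly tendsto_ident_at)
  then have ev2: "\<forall>\<^sub>F x in at_left S. L / 2 < poly (T i 1) x"
    by (rule order_tendstoD) (use L in \<open>simp add: L_def\<close>)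
  show thesis
  proof (rule that[of B "L / (2 * B)" 1])
    show "B > 0" "L / (2 * B) > 0" using B L by (auto simp: L_def)
    show "\<forall>\<^sub>F x in at_upper s. poly 1 x > 0 \<and> (1 + \<bar>x\<bar>) ^ d \<le> B * poly 1 x \<and>
       poly 1 x \<le> B * (1 + \<bar>x\<bar>) ^ d \<and> L / (2 * B) * (1 + \<bar>x\<bar>) ^ Suc d \<le> poly (T i 1) x"
      unfolding real at_upper_simps using ev1 ev2
    proof eventually_elim
      case (elim x)
      have "(1 + \<bar>x\<bar>) ^ d \<le> (1 + \<bar>x\<bar>) ^ Suc d" by (intro power_increasing) auto
      then have "(1 + \<bar>x\<bar>) ^ d \<le> B" using elim by linarith
      moreover have "1 * 1 \<le> B * (1 + \<bar>x\<bar>) ^ d" using B by (intro mult_mono) auto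
      moreover have "L / (2 * B) * (1 + \<bar>x\<bar>) ^ Suc d \<le> L / (2 * B) * B"
        using elim B L by (intro mult_left_mono) (auto simp: L_def)
      moreover have "L / (2 * B) * B = L / 2" using B by simp
      ultimately show ?case using elim by simp
    qed
    have "((\<lambda>x. poly q x ^ i * (poly q x * f x)) \<longlongrightarrow> poly q S ^ i * 0) (at_upper s)"
      using qf_upper unfolding real at_upper_simps
      by (intro tendsto_mult tendsto_power tendsto_poly tendsto_ident_at)
    then show "((\<lambda>x. poly q x ^ Suc i * f x * poly 1 x) \<longlongrightarrow> 0) (at_upper s)"
      by (simp add: mult_ac)
  qed
next
  case PInf
  have pos: "degree (T i (monom 1 n)) \<le> Suc n" "coeff (T i (monom 1 n)) (Suc n) > 0" for n
  proof -
    have "real (2 * i + n) * coeff q 2 \<le> 0" by (intro mult_nonneg_nonpos lead_nonpos) simp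
    then show "degree (T i (monom 1 n)) \<le> Suc n" "coeff (T i (monom 1 n)) (Suc n) > 0"
      using T_degree_coeff[of "monom 1 n" n i] by (simp_all add: degree_monom_le del: of_nat_add of_nat_mult)
  qed
  obtain \<epsilon> where \<epsilon>: "\<epsilon> > 0" "\<forall>\<^sub>F x in at_top. \<epsilon> * (1 + \<bar>x\<bar>) ^ Suc d \<le> poly (T i (monom 1 d)) x"
    using poly_ge_at_top[OF pos[of d]] .
  show thesis
  proof (rule that[of "2 ^ d" \<epsilon> "monom 1 d"])
    show "(2::real) ^ d > 0" "\<epsilon> > 0" using \<epsilon> by auto
    show "\<forall>\<^sub>F x in at_upper s. poly (monom 1 d) x > 0 \<and> (1 + \<bar>x\<bar>) ^ d \<le> 2 ^ d * poly (monom 1 d) x \<and>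
       poly (monom 1 d) x \<le> 2 ^ d * (1 + \<bar>x\<bar>) ^ d \<and> \<epsilon> * (1 + \<bar>x\<bar>) ^ Suc d \<le> poly (T i (monom 1 d)) x"
      unfolding PInf at_upper_simps using \<epsilon>(2) eventually_ge_at_top[of 1]
    proof eventually_elim
      case (elim x)
      have "(1 + \<bar>x\<bar>) ^ d \<le> (2 * x) ^ d" using elim by (intro power_mono) auto
      moreover have "1 * x ^ d \<le> 2 ^ d * (1 + \<bar>x\<bar>) ^ d"
        using elim by (intro mult_mono power_mono) auto
      ultimately show ?case using elim by (simp add: poly_monom power_mult_distrib)
    qed
    obtain \<epsilon>' where \<epsilon>': "\<epsilon>' > 0"
      "\<forall>\<^sub>F x in at_top. \<epsilon>' * (1 + \<bar>x\<bar>) ^ Suc (Suc d) \<le> poly (T i (monom 1 (Suc d))) x"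
      using poly_ge_at_top[OF pos[of "Suc d"]] .
    then have "\<forall>\<^sub>F x in at_upper s. \<epsilon>' * (1 + \<bar>x\<bar>) ^ Suc (Suc d) \<le> poly (T i (monom 1 (Suc d))) x"
      using PInf by simp
    then have "\<forall>\<^sub>F x in at_upper s. 0 \<le> poly (T i (monom 1 (Suc d))) x \<and> x \<in> einterval r s"
      using eventually_in
    proof eventually_elim
      case (elim x)
      moreover have "\<epsilon>' * (1 + \<bar>x\<bar>) ^ Suc (Suc d) \<ge> 0" using \<epsilon>'(1) by simp
      ultimately show ?case by linarith
    qed
    then obtain c where cx: "\<And>x. c < x \<Longrightarrow> 0 \<le> poly (T i (monom 1 (Suc d))) x \<and> x \<in> einterval r s"
      using eventually_at_upper[OF r_less_s] PInf by auto
    \<comment> \<open>One power higher than needed: this function is eventually decreasing, hence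
      bounded, and division by x sends the required weight to 0.\<close>
    define V where "V x = poly q x ^ Suc i * f x * poly (monom 1 (Suc d)) x" for x
    have V_anti: "V x \<le> V (c + 1)" if "c + 1 \<le> x" for x
    proof (rule DERIV_nonpos_imp_nonincreasing[OF that])
      fix y assume "c + 1 \<le> y"
      then have y: "y \<in> einterval r s" "0 \<le> poly (T i (monom 1 (Suc d))) y" using cx[of y] by auto
      then have "0 \<le> poly q y ^ i * f y * poly (T i (monom 1 (Suc d))) y"
        using q_pos[of y] f_pos[of y] by simp
      then show "\<exists>z. DERIV V y :> z \<and> z \<le> 0"
        using weight_deriv[OF y(1), of i "monom 1 (Suc d)"] unfolding V_def[abs_def]
        by (intro exI conjI) auto
    qed
    show "((\<lambda>x. poly q x ^ Suc i * f x * poly (monom 1 d) x) \<longlongrightarrow> 0) (at_upper s)"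
    proof (rule Lim_null_comparison)
      show "((\<lambda>x. V (c + 1) / x) \<longlongrightarrow> 0) (at_upper s)"
        unfolding PInf at_upper_simps
        by (intro tendsto_divide_0[OF tendsto_const] filterlim_at_top_imp_at_infinity filterlim_ident)
      show "\<forall>\<^sub>F x in at_upper s. norm (poly q x ^ Suc i * f x * poly (monom 1 d) x) \<le> V (c + 1) / x"
        unfolding PInf at_upper_simps using eventually_ge_at_top[of "max 1 (c + 1)"]
      proof eventually_elim
        case (elim x)
        then have x: "x \<ge> 1" "c + 1 \<le> x" "x \<in> einterval r s" using cx[of x] by auto
        have "norm (poly q x ^ Suc i * f x * poly (monom 1 d) x) = V x / x"
          using x(1) q_pos[OF x(3)] f_pos[OF x(3)] by (simp add: V_def poly_monom abs_mult)
        also have "\<dots> \<le> V (c + 1) / x" using V_anti[OF x(2)] x(1) by (intro divide_right_mono) auto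
        finally show ?case .
      qed
    qed
  qed
qed (use r_less_s in simp)

text \<open>The end estimate is applied to W = q^(i+1) f R with -W' = q^i f (T i R). Since T i
  raises the growth by one order, the bound for V |h| carries the additional power of 1 +
  |x|.\<close>

lemma upper_end:
  fixes h h' :: "real \<Rightarrow> real"
  assumes h: "\<And>x. x \<in> einterval r s \<Longrightarrow> (h has_real_derivative h' x) (at x)"
    and h'_cont: "continuous_on (einterval r s) h'"
    and int: "set_integrable lborel (einterval r s) (\<lambda>x. poly q x ^ Suc i * f x * (1 + \<bar>x\<bar>) ^ d * \<bar>h' x\<bar>)"
  shows "\<exists>c\<in>einterval r s. set_integrable lborel (einterval c s) (\<lambda>x. poly q x ^ i * f x * (1 + \<bar>x\<bar>) ^ Suc d * \<bar>h x\<bar>)"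
    and "degree Q \<le> d \<Longrightarrow> ((\<lambda>x. poly q x ^ Suc i * f x * poly Q x * h x) \<longlongrightarrow> 0) (at_upper s)"
proof -
  obtain R K \<epsilon> where K: "K > 0" and \<epsilon>: "\<epsilon> > 0"
    and ev: "\<forall>\<^sub>F x in at_upper s. poly R x > 0 \<and> (1 + \<bar>x\<bar>) ^ d \<le> K * poly R x \<and>
       poly R x \<le> K * (1 + \<bar>x\<bar>) ^ d \<and> \<epsilon> * (1 + \<bar>x\<bar>) ^ Suc d \<le> poly (T i R) x"
    and lim: "((\<lambda>x. poly q x ^ Suc i * f x * poly R x) \<longlongrightarrow> 0) (at_upper s)"
    by (rule weight_exists[of d i]) (rule that; assumption)
  obtain b where b: "b \<in> einterval r s"
    and bx: "\<And>x. b < x \<Longrightarrow> ereal x < s \<Longrightarrow> poly R x > 0 \<and> (1 + \<bar>x\<bar>) ^ d \<le> K * poly R x \<and>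
       poly R x \<le> K * (1 + \<bar>x\<bar>) ^ d \<and> \<epsilon> * (1 + \<bar>x\<bar>) ^ Suc d \<le> poly (T i R) x"
    using ev unfolding eventually_at_upper[OF r_less_s] by blast
  obtain c where c: "b < c" "ereal c < s"
    using b ereal_dense2[of "ereal b" s] by (auto simp: einterval_iff)
  have inE: "x \<in> einterval r s" if "c \<le> x" "ereal x < s" for x
    using between[OF b _ order_refl that(2)] that c by simp
  let ?C = "{x. c \<le> x \<and> ereal x < s}"
  have sub: "?C \<subseteq> einterval r s" using inE by auto
  have subC: "{c..x} \<subseteq> ?C" if "ereal x < s" for x
    using that by (auto intro: le_less_trans[of "ereal _" "ereal x" s])
  define W where "W x = poly q x ^ Suc i * f x * poly R x" for x
  define V where "V x = poly q x ^ i * f x * poly (T i R) x" for x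
  define \<psi> where "\<psi> x = poly q x ^ Suc i * f x * (1 + \<bar>x\<bar>) ^ d * \<bar>h' x\<bar>" for x
  define \<phi> where "\<phi> x = poly q x ^ i * f x * (1 + \<bar>x\<bar>) ^ Suc d * \<bar>h x\<bar>" for x
  have h_cont: "continuous_on (einterval r s) h"
    by (rule continuous_at_imp_continuous_on) (auto intro: DERIV_isCont[OF h])
  note cont = h_cont[THEN continuous_on_subset, OF sub] h'_cont[THEN continuous_on_subset, OF sub]
    f_continuous[THEN continuous_on_subset, OF sub]
  have cW: "continuous_on ?C (\<lambda>x. W x * \<bar>h' x\<bar>)" unfolding W_def by (intro continuous_intros cont)
  have cV: "continuous_on ?C V" unfolding V_def by (intro continuous_intros cont)
  have cVh: "continuous_on ?C (\<lambda>x. V x * \<bar>h x\<bar>)" by (intro continuous_intros cont cV)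
  have c\<psi>: "continuous_on ?C \<psi>" unfolding \<psi>_def by (intro continuous_intros cont)
  have c\<phi>: "continuous_on ?C \<phi>" unfolding \<phi>_def by (intro continuous_intros cont)
  have iC: "k integrable_on {c..x}" if "ereal x < s" "continuous_on ?C k" for x and k :: "real \<Rightarrow> real"
    using continuous_on_subset[OF that(2) subC[OF that(1)]] by (rule integrable_continuous_interval)
  have W_deriv: "(W has_real_derivative - V x) (at x)" if "c \<le> x" "ereal x < s" for x
    unfolding W_def V_def by (rule weight_deriv[OF inE[OF that]])
  have W_pos: "W x > 0" and V_ge: "\<epsilon> * (poly q x ^ i * f x * (1 + \<bar>x\<bar>) ^ Suc d) \<le> V x"
    and W_le: "W x \<le> K * (poly q x ^ Suc i * f x * (1 + \<bar>x\<bar>) ^ d)"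
    and W_ge: "poly q x ^ Suc i * f x * (1 + \<bar>x\<bar>) ^ d \<le> K * W x"
    if x: "c \<le> x" "ereal x < s" for x
  proof -
    note * = bx[of x] inE[OF x] q_pos[OF inE[OF x]] f_pos[OF inE[OF x]]
    show "W x > 0" using * x c by (simp add: W_def)
    have "poly q x ^ i * f x * (\<epsilon> * (1 + \<bar>x\<bar>) ^ Suc d) \<le> V x"
      unfolding V_def using * x c by (intro mult_left_mono) auto
    then show "\<epsilon> * (poly q x ^ i * f x * (1 + \<bar>x\<bar>) ^ Suc d) \<le> V x" by (simp only: mult_ac)
    have "W x \<le> poly q x ^ Suc i * f x * (K * (1 + \<bar>x\<bar>) ^ d)"
      unfolding W_def using * x c by (intro mult_left_mono) auto
    then show "W x \<le> K * (poly q x ^ Suc i * f x * (1 + \<bar>x\<bar>) ^ d)" by (simp only: mult_ac)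
    have "poly q x ^ Suc i * f x * (1 + \<bar>x\<bar>) ^ d \<le> poly q x ^ Suc i * f x * (K * poly R x)"
      using * x c by (intro mult_left_mono) auto
    then show "poly q x ^ Suc i * f x * (1 + \<bar>x\<bar>) ^ d \<le> K * W x" by (simp only: W_def mult_ac)
  qed
  have \<psi>_nonneg: "0 \<le> \<psi> x" if "x \<in> einterval r s" for x
    using q_pos[OF that] f_pos[OF that] by (simp add: \<psi>_def)
  have V_nonneg: "0 \<le> V x" if "c \<le> x" "ereal x < s" for x
    using V_ge[OF that] \<epsilon> q_pos[OF inE[OF that]] f_pos[OF inE[OF that]]
    by (auto elim!: order_trans[rotated])
  define B where "B = K * integral (einterval r s) \<psi>"
  have bound: "integral {c..x} (\<lambda>x. W x * \<bar>h' x\<bar>) \<le> B" if x: "c \<le> x" "ereal x < s" for x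
  proof -
    have "integral {c..x} (\<lambda>x. W x * \<bar>h' x\<bar>) \<le> integral {c..x} (\<lambda>x. K * \<psi> x)"
    proof (intro integral_le iC x cW continuous_intros c\<psi>)
      fix y assume "y \<in> {c..x}"
      then have "c \<le> y" "ereal y < s" using subC[OF x(2)] by auto
      then have "W y * \<bar>h' y\<bar> \<le> K * (poly q y ^ Suc i * f y * (1 + \<bar>y\<bar>) ^ d) * \<bar>h' y\<bar>"
        by (intro mult_right_mono W_le) auto
      then show "W y * \<bar>h' y\<bar> \<le> K * \<psi> y" by (simp only: \<psi>_def mult_ac)
    qed
    also have "\<dots> = K * integral {c..x} \<psi>" by simp
    also have "integral {c..x} \<psi> \<le> integral (einterval r s) \<psi>"
      using set_borel_integral_eq_integral(1)[OF int] subC[OF x(2)] sub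
      by (intro integral_subset_le iC x c\<psi> ballI \<psi>_nonneg) (auto simp: \<psi>_def[abs_def])
    finally show ?thesis using K by (simp add: B_def)
  qed
  note est = right_end_estimate[where c = c and s = s and W = W and V = V and h = h and h' = h' and B = B,
      OF c(2) W_deriv less_imp_le[OF W_pos] V_nonneg cV h[OF inE] cont(2) bound]
  have "set_integrable lborel (einterval c s) \<phi>"
  proof (rule set_integrable_einterval_bounded[OF c(2) c\<phi>])
    fix x assume x: "c \<le> x" "ereal x < s"
    show "0 \<le> \<phi> x" using q_pos[OF inE[OF x]] f_pos[OF inE[OF x]] by (simp add: \<phi>_def)
    have "\<epsilon> * integral {c..x} \<phi> = integral {c..x} (\<lambda>x. \<epsilon> * \<phi> x)" by simp
    also have "\<dots> \<le> integral {c..x} (\<lambda>x. V x * \<bar>h x\<bar>)"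
    proof (intro integral_le iC x cVh continuous_intros c\<phi>)
      fix y assume "y \<in> {c..x}"
      then have "c \<le> y" "ereal y < s" using subC[OF x(2)] by auto
      then have "\<epsilon> * (poly q y ^ i * f y * (1 + \<bar>y\<bar>) ^ Suc d) * \<bar>h y\<bar> \<le> V y * \<bar>h y\<bar>"
        by (intro mult_right_mono V_ge) auto
      then show "\<epsilon> * \<phi> y \<le> V y * \<bar>h y\<bar>" by (simp only: \<phi>_def mult_ac)
    qed
    also have "\<dots> \<le> W c * \<bar>h c\<bar> + B" by (rule est(1); use x in simp)
    finally show "integral {c..x} \<phi> \<le> (W c * \<bar>h c\<bar> + B) / \<epsilon>" using \<epsilon> by (simp add: field_simps)
  qed
  then show "\<exists>c\<in>einterval r s. set_integrable lborel (einterval c s) (\<lambda>x. poly q x ^ i * f x * (1 + \<bar>x\<bar>) ^ Suc d * \<bar>h x\<bar>)"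
    using inE[OF order_refl c(2)] unfolding \<phi>_def[abs_def] by blast
  have limWh: "((\<lambda>x. W x * h x) \<longlongrightarrow> 0) (at_upper s)"
    by (rule est(2); (rule lim[folded W_def] | simp))
  show "((\<lambda>x. poly q x ^ Suc i * f x * poly Q x * h x) \<longlongrightarrow> 0) (at_upper s)" if "degree Q \<le> d"
  proof -
    obtain C where C: "C \<ge> 0" "\<And>x. \<bar>poly Q x\<bar> \<le> C * (1 + \<bar>x\<bar>) ^ d"
      using abs_poly_le[OF \<open>degree Q \<le> d\<close>] by blast
    show ?thesis
    proof (rule Lim_null_comparison)
      show "((\<lambda>x. C * K * \<bar>W x * h x\<bar>) \<longlongrightarrow> 0) (at_upper s)"
        using limWh by (intro tendsto_mult_right_zero tendsto_rabs_zero)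
      show "\<forall>\<^sub>F x in at_upper s. norm (poly q x ^ Suc i * f x * poly Q x * h x) \<le> C * K * \<bar>W x * h x\<bar>"
        using eventually_at_upper_greater[OF c(2)]
      proof eventually_elim
        case (elim x)
        then have x: "c \<le> x" "ereal x < s" by auto
        note pos = q_pos[OF inE[OF x]] f_pos[OF inE[OF x]]
        have "norm (poly q x ^ Suc i * f x * poly Q x * h x) = poly q x ^ Suc i * f x * \<bar>poly Q x\<bar> * \<bar>h x\<bar>"
          using pos by (simp add: abs_mult)
        also have "\<dots> \<le> poly q x ^ Suc i * f x * (C * (1 + \<bar>x\<bar>) ^ d) * \<bar>h x\<bar>"
          using pos by (intro mult_right_mono mult_left_mono C) auto
        also have "\<dots> = C * (poly q x ^ Suc i * f x * (1 + \<bar>x\<bar>) ^ d) * \<bar>h x\<bar>" by (simp only: mult_ac)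
        also have "\<dots> \<le> C * (K * W x) * \<bar>h x\<bar>"
          by (intro mult_right_mono mult_left_mono W_ge x C(1)) auto
        also have "\<dots> = C * K * \<bar>W x * h x\<bar>" using W_pos[OF x] by (simp add: abs_mult)
        finally show ?case .
      qed
    qed
  qed
qed

lemma set_integrable_weighted:
  assumes int: "set_integrable lborel (einterval r s) (\<lambda>x. poly q x ^ i * f x * (1 + \<bar>x\<bar>) ^ d * \<bar>k x\<bar>)"
    and k: "continuous_on (einterval r s) k" and "degree Q \<le> d"
  shows "set_integrable lborel (einterval r s) (\<lambda>x. poly q x ^ i * f x * poly Q x * k x)"
proof -
  obtain C where C: "C \<ge> 0" "\<And>x. \<bar>poly Q x\<bar> \<le> C * (1 + \<bar>x\<bar>) ^ d"
    using abs_poly_le[OF \<open>degree Q \<le> d\<close>] by blast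
  have "continuous_on (einterval r s) (\<lambda>x. poly q x ^ i * f x * poly Q x * k x)"
    by (intro continuous_intros k f_continuous)
  then have meas: "set_borel_measurable lborel (einterval r s) (\<lambda>x. poly q x ^ i * f x * poly Q x * k x)"
    by (intro set_borel_measurable_lborel borel_einterval)
  show ?thesis
  proof (rule set_integrable_bound[OF set_integrable_mult_right[OF int, of C] meas], intro AE_I2 impI)
    fix x assume x: "x \<in> einterval r s"
    have "norm (poly q x ^ i * f x * poly Q x * k x) = poly q x ^ i * f x * \<bar>poly Q x\<bar> * \<bar>k x\<bar>"
      using q_pos[OF x] f_pos[OF x] by (simp add: abs_mult)
    also have "\<dots> \<le> poly q x ^ i * f x * (C * (1 + \<bar>x\<bar>) ^ d) * \<bar>k x\<bar>"
      using q_pos[OF x] f_pos[OF x] by (intro mult_right_mono mult_left_mono C) auto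
    also have "\<dots> = C * (poly q x ^ i * f x * (1 + \<bar>x\<bar>) ^ d * \<bar>k x\<bar>)"
      by (simp only: mult_ac)
    also have "\<dots> \<le> norm \<dots>" by simp
    finally show "norm (poly q x ^ i * f x * poly Q x * k x)
      \<le> norm (C * (poly q x ^ i * f x * (1 + \<bar>x\<bar>) ^ d * \<bar>k x\<bar>))" .
  qed
qed

text \<open>Integration by parts of q^(i+1) f Q against h'. Integrability and vanishing boundary
  terms come from \<open>upper_end\<close>, applied once directly and once to the reflected
  data.\<close>

lemma stein_step:
  fixes h h' :: "real \<Rightarrow> real"
  assumes h: "\<And>x. x \<in> einterval r s \<Longrightarrow> (h has_real_derivative h' x) (at x)"
    and h'_cont: "continuous_on (einterval r s) h'"
    and int: "set_integrable lborel (einterval r s) (\<lambda>x. poly q x ^ Suc i * f x * (1 + \<bar>x\<bar>) ^ d * \<bar>h' x\<bar>)"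
  shows "set_integrable lborel (einterval r s) (\<lambda>x. poly q x ^ i * f x * (1 + \<bar>x\<bar>) ^ Suc d * \<bar>h x\<bar>)"
    and "degree Q \<le> d \<Longrightarrow>
      (LBINT x:einterval r s. poly q x ^ Suc i * f x * poly Q x * h' x) =
      (LBINT x:einterval r s. poly q x ^ i * f x * poly (T i Q) x * h x)"
proof -
  interpret R: pearson "\<lambda>x. f (- x)" "- m" "pcompose q [:0, -1:]" "- s" "- r" by (rule reflect)
  let ?p = "\<lambda>Q. pcompose Q [:0, -1:] :: real poly"
  define \<phi> where "\<phi> x = poly q x ^ i * f x * (1 + \<bar>x\<bar>) ^ Suc d * \<bar>h x\<bar>" for x
  have hR: "((\<lambda>x. h (- x)) has_real_derivative - h' (- x)) (at x)" if "x \<in> einterval (- s) (- r)" for x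
    using h that by (simp add: in_einterval_uminus_iff flip: DERIV_mirror)
  have h'R: "continuous_on (einterval (- s) (- r)) (\<lambda>x. - h' (- x))"
    by (intro continuous_intros continuous_on_compose2[OF h'_cont]) (auto simp: in_einterval_uminus_iff)
  have intR: "set_integrable lborel (einterval (- s) (- r))
     (\<lambda>x. poly (?p q) x ^ Suc i * f (- x) * (1 + \<bar>x\<bar>) ^ d * \<bar>- h' (- x)\<bar>)"
    using int unfolding set_integrable_einterval_uminus[of r s] by (simp add: poly_pcompose)
  obtain c2 where c2: "c2 \<in> einterval r s" "set_integrable lborel (einterval c2 s) \<phi>"
    using upper_end(1)[OF h h'_cont int] unfolding \<phi>_def by blast
  obtain c where c: "c \<in> einterval (- s) (- r)"
    "set_integrable lborel (einterval c (- r)) (\<lambda>x. \<phi> (- x))"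
    using R.upper_end(1)[OF hR h'R intR] by (auto simp: \<phi>_def[abs_def] poly_pcompose)
  define c1 where "c1 = - c"
  have c1: "c1 \<in> einterval r s" "set_integrable lborel (einterval r c1) \<phi>"
    using c set_integrable_einterval_uminus[of r "ereal c1" \<phi>]
    by (auto simp: c1_def in_einterval_uminus_iff)
  have h_cont: "continuous_on (einterval r s) h"
    by (rule continuous_at_imp_continuous_on) (auto intro: DERIV_isCont[OF h])
  \<comment> \<open>A compact middle piece joins the two end neighbourhoods, whichever of c1 and c2
    is larger; continuity suffices on it.\<close>
  have "set_integrable lborel {min c1 c2..max c1 c2} \<phi>"
  proof (rule borel_integrable_atLeastAtMost')
    have "{min c1 c2..max c1 c2} \<subseteq> einterval r s"
    proof
      fix x assume "x \<in> {min c1 c2..max c1 c2}"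
      then show "x \<in> einterval r s"
        using between[of "min c1 c2" x "max c1 c2"] c1(1) c2(1)
        by (auto simp: einterval_iff min_def max_def split: if_splits)
    qed
    then show "continuous_on {min c1 c2..max c1 c2} \<phi>"
      unfolding \<phi>_def
      by (intro continuous_intros h_cont[THEN continuous_on_subset] f_continuous[THEN continuous_on_subset])
  qed
  then have "set_integrable lborel ((einterval r c1 \<union> {min c1 c2..max c1 c2}) \<union> einterval c2 s) \<phi>"
    using c1(2) c2(2) by (intro set_integrable_Un) auto
  then have \<phi>: "set_integrable lborel (einterval r s) \<phi>"
    by (rule set_integrable_subset) (auto simp: einterval_iff)
  then show int': "set_integrable lborel (einterval r s) (\<lambda>x. poly q x ^ i * f x * (1 + \<bar>x\<bar>) ^ Suc d * \<bar>h x\<bar>)"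
    by (simp only: \<phi>_def[abs_def])
  assume Q: "degree Q \<le> d"
  define G where "G x = poly q x ^ Suc i * f x * poly Q x * h x" for x
  define A where "A x = poly q x ^ Suc i * f x * poly Q x * h' x" for x
  define B where "B x = poly q x ^ i * f x * poly (T i Q) x * h x" for x
  have iA: "set_integrable lborel (einterval r s) A"
    unfolding A_def[abs_def] by (rule set_integrable_weighted[OF int h'_cont Q])
  have iB: "set_integrable lborel (einterval r s) B"
    unfolding B_def[abs_def]
    by (rule set_integrable_weighted[OF int' h_cont conjunct1[OF T_degree_coeff[OF Q]]])
  \<comment> \<open>The integrand is the derivative of G = q^(i+1) f Q h, which vanishes at both
    ends.\<close>
  have "(LBINT x=r..s. A x - B x) = 0 - 0"
  proof (rule interval_integral_FTC_integrable[OF r_less_s])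
    fix x assume "r < ereal x" "ereal x < s"
    then have x: "x \<in> einterval r s" by (simp add: einterval_iff)
    have "(G has_real_derivative - (poly q x ^ i * f x * poly (T i Q) x) * h x
        + h' x * (poly q x ^ Suc i * f x * poly Q x)) (at x)"
      unfolding G_def[abs_def] by (rule DERIV_mult[OF weight_deriv[OF x] h[OF x]])
    then show "(G has_vector_derivative A x - B x) (at x)"
      by (simp add: A_def B_def has_real_derivative_iff_has_vector_derivative mult_ac)
    have "isCont h' x"
      using h'_cont x by (simp add: continuous_on_eq_continuous_at)
    then show "isCont (\<lambda>x. A x - B x) x"
      unfolding A_def B_def
      by (intro continuous_intros f_isCont[OF x] DERIV_isCont[OF h[OF x]])
  next
    show "set_integrable lborel (einterval r s) (\<lambda>x. A x - B x)"
      by (intro set_integral_diff iA iB)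
    show "((G \<circ> real_of_ereal) \<longlongrightarrow> 0) (at_left s)"
      using upper_end(2)[OF h h'_cont int Q] unfolding tendsto_at_upper_iff G_def[abs_def] .
    have "((\<lambda>x. G (- x)) \<longlongrightarrow> 0) (at_upper (- r))"
      using R.upper_end(2)[OF hR h'R intR, of "?p Q"] Q
      by (simp add: G_def poly_pcompose degree_pcompose)
    then show "((G \<circ> real_of_ereal) \<longlongrightarrow> 0) (at_right r)"
      using r_less_s by (subst tendsto_at_right_iff_at_upper_uminus) auto
  qed
  then have "(LBINT x:einterval r s. A x - B x) = 0"
    using r_less_s by (simp add: interval_lebesgue_integral_le_eq)
  then show "(LBINT x:einterval r s. poly q x ^ Suc i * f x * poly Q x * h' x) =
      (LBINT x:einterval r s. poly q x ^ i * f x * poly (T i Q) x * h x)"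
    using set_integral_diff(2)[OF iA iB] by (simp add: A_def B_def)
qed

text \<open>D is an abstract chain of successive derivatives, so the identity serves g and, through
  \<open>pderiv\<close>, every polynomial as well.\<close>

lemma stein_rodrigues:
  assumes D: "\<And>k x. x \<in> einterval r s \<Longrightarrow> (D k has_real_derivative D (Suc k) x) (at x)"
    and int: "\<And>k. set_integrable lborel (einterval r s) (\<lambda>x. poly q x ^ k * f x * \<bar>D k x\<bar>)"
  shows "(LBINT x:einterval r s. poly q x ^ k * f x * poly Q x * D k x) =
    (LBINT x:einterval r s. f x * poly (lower T k Q) x * D 0 x)"
proof -
  have D_cont: "continuous_on (einterval r s) (D k)" for k
    by (rule continuous_at_imp_continuous_on) (auto intro: DERIV_isCont[OF D])
  \<comment> \<open>Induction on d for all i together: power d + 1 at order i rests on power d at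
    order i + 1, and ultimately on order i + d + 1 without any power.\<close>
  have int': "set_integrable lborel (einterval r s) (\<lambda>x. poly q x ^ i * f x * (1 + \<bar>x\<bar>) ^ d * \<bar>D i x\<bar>)" for i d
  proof (induction d arbitrary: i)
    case 0
    then show ?case using int by simp
  next
    case (Suc d)
    show ?case by (rule stein_step(1)[OF D D_cont Suc.IH])
  qed
  show ?thesis
  proof (induction k arbitrary: Q)
    case 0
    then show ?case by simp
  next
    case (Suc k)
    have "(LBINT x:einterval r s. poly q x ^ Suc k * f x * poly Q x * D (Suc k) x) =
      (LBINT x:einterval r s. poly q x ^ k * f x * poly (T k Q) x * D k x)"
      by (rule stein_step(2)[OF D D_cont int' order_refl])
    then show ?case using Suc.IH[of "T k Q"] by simp
  qed
qed

text \<open>Iterated parts with the derivatives of R: the k-th one is constant and leaves the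
  integral.\<close>

lemma rodrigues_orthogonal:
  assumes "degree R \<le> k"
  shows "(LBINT x:einterval r s. f x * poly (lower T k 1) x * poly R x) =
    fact k * (LBINT x:einterval r s. poly q x ^ k * f x) * coeff R k"
proof -
  have "(LBINT x:einterval r s. poly q x ^ k * f x * poly 1 x * poly ((pderiv ^^ k) R) x) =
    (LBINT x:einterval r s. f x * poly (lower T k 1) x * poly ((pderiv ^^ 0) R) x)"
  proof (rule stein_rodrigues[where D = "\<lambda>k. poly ((pderiv ^^ k) R)"])
    show "(poly ((pderiv ^^ k) R) has_real_derivative poly ((pderiv ^^ Suc k) R) x) (at x)" for k x
      using poly_DERIV[of "(pderiv ^^ k) R" x] by simp
    fix k
    have "set_integrable lborel (einterval r s) (\<lambda>x. \<bar>f x * poly (q ^ k * (pderiv ^^ k) R) x\<bar>)"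
      by (intro set_integrable_abs integrable_f_poly)
    then show "set_integrable lborel (einterval r s) (\<lambda>x. poly q x ^ k * f x * \<bar>poly ((pderiv ^^ k) R) x\<bar>)"
      by (rule set_integrable_cong[THEN iffD1, rotated -1])
         (auto simp: abs_mult q_pos f_pos less_imp_le mult_ac)
  qed
  moreover have "(LBINT x:einterval r s. fact k * coeff R k * (poly q x ^ k * f x)) =
      fact k * coeff R k * (LBINT x:einterval r s. poly q x ^ k * f x)"
    by (rule set_integral_mult_right)
  ultimately show ?thesis
    by (simp only: higher_pderiv_eq_const[OF assms] poly_pCons poly_0 poly_1 mult_zero_right
        add_0_right mult_1_right mult_1_left mult_ac funpow_0)
qed

end

section \<open>From a density satisfying the integral identity to the expansion in part (a)\<close>

lemma lborel_integral_pos: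
  fixes \<phi> :: "real \<Rightarrow> real"
  assumes int: "integrable lborel \<phi>" and nonneg: "\<And>x. 0 \<le> \<phi> x"
    and "a < b" and pos: "\<And>x. a < x \<Longrightarrow> x < b \<Longrightarrow> 0 < \<phi> x"
  shows "0 < (\<integral>x. \<phi> x \<partial>lborel)"
proof (rule ccontr)
  assume "\<not> 0 < (\<integral>x. \<phi> x \<partial>lborel)"
  moreover have "0 \<le> (\<integral>x. \<phi> x \<partial>lborel)" by (simp add: nonneg)
  ultimately have "(\<integral>x. \<phi> x \<partial>lborel) = 0" by linarith
  then have "AE x in lborel. \<phi> x = 0"
    using integral_nonneg_eq_0_iff_AE[OF int] nonneg by simp
  then have "AE x in lborel. x \<notin> {a<..<b}"
    by eventually_elim (use pos in force)
  then have "{a<..<b} \<in> null_sets lborel"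
    by (subst AE_iff_null_sets) auto
  then show False using \<open>a < b\<close> by (simp add: null_sets_def)
qed

text \<open>Regularity is bootstrapped from the integral identity. Its left side F is continuous,
  and positive on the interval, hence so is q there; then f = F / q is continuous, and only now does
  the fundamental theorem differentiate F.\<close>

lemma pearson_of_density:
  fixes f :: "real \<Rightarrow> real" and q :: "real poly"
  assumes "prob_space M" and [measurable]: "X \<in> borel_measurable M"
    and moments: "\<And>n :: nat. integrable M (\<lambda>\<omega>. X \<omega> ^ n)"
    and f_nonneg: "\<And>x. 0 \<le> f x"
    and dist: "distributed M lborel X (\<lambda>x. ennreal (f x))"
    and eq: "\<And>x. (LBINT t:{..x}. (prob_space.expectation M X - t) * f t) = poly q x * f x"
    and supp: "{x. 0 < f x} = einterval r s"
    and degree: "degree q \<le> 2"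
  shows "pearson f (prob_space.expectation M X) q r s"
proof -
  interpret prob_space M by fact
  let ?m = "expectation X"
  have [measurable]: "f \<in> borel_measurable borel"
    using distributed_real_measurable[OF f_nonneg dist] by simp
  have int_f: "integrable lborel (\<lambda>x. f x * x ^ n)" for n
    using distributed_integrable[OF dist, of "\<lambda>x. x ^ n"] f_nonneg moments by simp
  have E: "x \<in> einterval r s \<longleftrightarrow> 0 < f x" for x using supp by auto
  have f_0: "f x = 0" if "x \<notin> einterval r s" for x
    using that f_nonneg[of x] by (simp add: E)
  have total: "(\<integral>x. f x \<partial>lborel) = 1"
    using distributed_integral[OF dist, of "\<lambda>x. 1"] f_nonneg prob_space by simp
  have "einterval r s \<noteq> {}"
  proof
    assume "einterval r s = {}"
    then have "f = (\<lambda>x. 0)" using f_0 by auto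
    with total show False by simp
  qed
  then have rs: "r < s" by (force simp: einterval_iff intro: less_trans)
  define w where "w t = (?m - t) * f t" for t
  have i01: "integrable lborel f" "integrable lborel (\<lambda>t. f t * t)"
    using int_f[of 0] int_f[of 1] by simp_all
  have w_eq: "w = (\<lambda>t. ?m * f t - f t * t)"
    by (simp add: w_def fun_eq_iff algebra_simps)
  have int_w: "integrable lborel w"
    unfolding w_eq using i01 by simp
  have int_w_set: "set_integrable lborel A w" if "A \<in> sets borel" for A
    unfolding set_integrable_def using int_w that by (intro integrable_mult_indicator) simp_all
  have total_w: "(\<integral>t. w t \<partial>lborel) = 0"
  proof -
    have "(\<integral>t. f t * t \<partial>lborel) = ?m"
      using distributed_integral[OF dist, of "\<lambda>x. x"] f_nonneg by simp
    then show ?thesis unfolding w_eq using i01 total by simp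
  qed
  define F where "F x = (LBINT t:{..x}. w t)" for x
  have F_eq: "F x = poly q x * f x" for x using eq[of x] by (simp add: F_def w_def)
  have F_integral: "F y = F a + integral {a..y} w" if "a \<le> y" for a y
  proof -
    have "F y = integral {..y} w"
      unfolding F_def by (rule set_borel_integral_eq_integral(2)[OF int_w_set]) simp
    also have "{..y} = {..a} \<union> {a..y}" using that by auto
    also have "integral ({..a} \<union> {a..y}) w = integral {..a} w + integral {a..y} w"
    proof (rule Henstock_Kurzweil_Integration.integral_Un)
      have "{..a} \<inter> {a..y} = {a}" using that by auto
      then show "negligible ({..a} \<inter> {a..y})" by simp
    qed (auto intro!: set_borel_integral_eq_integral(1) int_w_set)
    also have "integral {..a} w = F a"
      unfolding F_def by (rule set_borel_integral_eq_integral(2)[OF int_w_set, symmetric]) simp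
    finally show ?thesis .
  qed
  have F_cont: "isCont F x" for x
  proof -
    have "w integrable_on {x - 1..x + 1}"
      by (intro set_borel_integral_eq_integral(1) int_w_set) simp
    then have "continuous_on {x - 1..x + 1} (\<lambda>y. F (x - 1) + integral {x - 1..y} w)"
      by (intro continuous_intros indefinite_integral_continuous_1)
    then have "continuous_on {x - 1..x + 1} F"
      by (rule continuous_on_eq) (simp flip: F_integral)
    then have "continuous_on {x - 1<..<x + 1} F"
      by (rule continuous_on_subset) auto
    then show ?thesis by (simp add: continuous_on_eq_continuous_at)
  qed
  \<comment> \<open>For x up to the mean the integrand is nonnegative on the left of x. Beyond the
    mean F is minus the integral over the right of x, since the total is 0, and there the integrand
    is nonpositive.\<close>
  have F_pos: "F x > 0" if x: "x \<in> einterval r s" for x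
  proof (cases "x \<le> ?m")
    case True
    obtain a where a: "r < ereal a" "a < x"
      using x ereal_dense2[of r "ereal x"] by (auto simp: einterval_iff)
    have "0 < (\<integral>t. indicator {..x} t * w t \<partial>lborel)"
    proof (rule lborel_integral_pos[OF _ _ a(2)])
      show "integrable lborel (\<lambda>t. indicator {..x} t * w t)"
        using int_w_set[of "{..x}"] by (simp add: set_integrable_def)
      show "0 \<le> indicator {..x} t * w t" for t
        using True f_nonneg by (simp add: w_def indicator_def)
      show "0 < indicator {..x} t * w t" if "a < t" "t < x" for t
      proof -
        have "t \<in> einterval r s" using a x that
          by (auto simp: einterval_iff intro: less_trans[of r "ereal a"] less_trans[of _ "ereal x"])
        then show ?thesis using that True by (simp add: w_def E)
      qed
    qed
    then show ?thesis by (simp add: F_def set_lebesgue_integral_def)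
  next
    case False
    obtain b where b: "x < b" "ereal b < s"
      using x ereal_dense2[of "ereal x" s] by (auto simp: einterval_iff)
    have "0 < (\<integral>t. indicator {x<..} t * (- w t) \<partial>lborel)"
    proof (rule lborel_integral_pos[OF _ _ b(1)])
      show "integrable lborel (\<lambda>t. indicator {x<..} t * (- w t))"
        using int_w_set[of "{x<..}"] by (simp add: set_integrable_def)
      show "0 \<le> indicator {x<..} t * (- w t)" for t
        using False f_nonneg by (simp add: w_def indicator_def mult_nonpos_nonneg)
      show "0 < indicator {x<..} t * (- w t)" if "x < t" "t < b" for t
      proof -
        have "t \<in> einterval r s" using b x that
          by (auto simp: einterval_iff intro: less_trans[of r "ereal x"] less_trans[of _ "ereal b"])
        then show ?thesis using that False by (simp add: w_def E mult_neg_pos)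
      qed
    qed
    also have "(\<integral>t. indicator {x<..} t * (- w t) \<partial>lborel)
        = (\<integral>t. indicator {..x} t *\<^sub>R w t - w t \<partial>lborel)"
      by (rule Bochner_Integration.integral_cong) (auto simp: indicator_def)
    also have "\<dots> = F x - 0"
      unfolding F_def set_lebesgue_integral_def total_w[symmetric]
      using int_w_set[of "{..x}"] int_w
      by (intro Bochner_Integration.integral_diff) (simp_all add: set_integrable_def)
    finally show ?thesis by simp
  qed
  have q_pos: "poly q x > 0" if "x \<in> einterval r s" for x
    using F_pos[OF that] that by (simp add: F_eq E zero_less_mult_iff)
  have f_cont: "isCont f x" if x: "x \<in> einterval r s" for x
  proof -
    have "isCont (\<lambda>x. F x / poly q x) x"
      using q_pos[OF x] by (intro isCont_divide F_cont poly_isCont) simp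
    moreover have "\<forall>\<^sub>F y in nhds x. F y / poly q y = f y"
      using eventually_nhds_in_open[OF open_einterval x]
      by eventually_elim (use q_pos F_eq in force)
    ultimately show ?thesis using isCont_cong[of "\<lambda>x. F x / poly q x" f x] by blast
  qed
  have F_deriv: "(F has_real_derivative (?m - x) * f x) (at x)" if x: "x \<in> einterval r s" for x
  proof -
    obtain a where a: "r < ereal a" "a < x"
      using x ereal_dense2[of r "ereal x"] by (auto simp: einterval_iff)
    obtain b where b: "x < b" "ereal b < s"
      using x ereal_dense2[of "ereal x" s] by (auto simp: einterval_iff)
    have sub: "{a..b} \<subseteq> einterval r s"
      using a b by (auto simp: einterval_iff less_le_trans[of r "ereal a" "ereal _"]
          le_less_trans[of "ereal _" "ereal b" s])
    have "continuous_on {a..b} w"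
      unfolding w_def
      by (intro continuous_intros continuous_at_imp_continuous_on ballI f_cont) (use sub in auto)
    then have "((\<lambda>y. F a + integral {a..y} w) has_real_derivative 0 + w x) (at x within {a..b})"
      using a b by (intro DERIV_add DERIV_const integral_has_real_derivative) auto
    then have "((\<lambda>y. F a + integral {a..y} w) has_real_derivative w x) (at x)"
      using at_within_Icc_at[OF a(2) b(1)] by simp
    then have "(F has_real_derivative w x) (at x)"
      by (rule has_field_derivative_transform_within_open[of _ _ _ "{a<..<b}"])
         (use a b in \<open>simp_all flip: F_integral\<close>)
    then show ?thesis by (simp add: w_def)
  qed
  \<comment> \<open>A finite end lies outside the open interval, so f and with it F = q f vanish
    there, and F is continuous; at infinity the limit is the total integral, m - m = 0.\<close>
  have F_upper: "(F \<longlongrightarrow> 0) (at_upper s)"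
  proof (cases s)
    case (real S)
    have "f S = 0" by (rule f_0) (simp add: real einterval_iff)
    then have "F S = 0" by (simp add: F_eq)
    moreover have "(F \<longlongrightarrow> F S) (at_left S)"
      using F_cont[of S] unfolding isCont_def by (rule tendsto_mono[OF at_le, rotated]) simp
    ultimately show ?thesis by (simp add: real)
  next
    case PInf
    have "(F \<longlongrightarrow> (\<integral>t. w t \<partial>lborel)) at_top"
      using tendsto_integral_at_top[OF _ int_w] by (simp add: F_def[abs_def] set_lebesgue_integral_def)
    then show ?thesis by (simp add: PInf total_w)
  qed (use rs in simp)
  have F_lower: "((\<lambda>x. F (- x)) \<longlongrightarrow> 0) (at_upper (- r))"
  proof (cases r)
    case (real R)
    have "f R = 0" by (rule f_0) (simp add: real einterval_iff)
    then have "F R = 0" by (simp add: F_eq)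
    moreover have "isCont (\<lambda>x. F (- x)) (- R)"
      using F_cont[of R] by (intro isCont_o2[where f = uminus and g = F]) simp_all
    then have "((\<lambda>x. F (- x)) \<longlongrightarrow> F (- (- R))) (at_left (- R))"
      unfolding isCont_def by (rule tendsto_mono[OF at_le, rotated]) simp
    ultimately show ?thesis by (simp add: real)
  next
    case MInf
    let ?w = "\<lambda>t. w (0 + (- 1) * t)"
    have int: "integrable lborel ?w"
      using int_w by (subst lborel_integrable_real_affine_iff) auto
    have "F (- x) = (\<integral>t. ?w t \<partial>lborel) - (\<integral>t. indicator {..x} t *\<^sub>R ?w t \<partial>lborel)" for x
    proof -
      have "F (- x) = (\<integral>t. indicator {..- x} (0 + (- 1) * t) *\<^sub>R ?w t \<partial>lborel)"
        unfolding F_def set_lebesgue_integral_def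
        by (subst lborel_integral_real_affine[where c = "- 1" and t = 0]) simp_all
      \<comment> \<open>Equality only almost everywhere: after reflection the half-line is t \<ge>
        x, while the complement of \<open>{..x}\<close> omits t = x.\<close>
      also have "\<dots> = (\<integral>t. ?w t - indicator {..x} t *\<^sub>R ?w t \<partial>lborel)"
        by (rule integral_cong_AE)
           (use AE_lborel_singleton[of x] in \<open>auto simp: w_def indicator_def elim!: eventually_mono\<close>)
      also have "\<dots> = (\<integral>t. ?w t \<partial>lborel) - (\<integral>t. indicator {..x} t *\<^sub>R ?w t \<partial>lborel)"
        by (intro Bochner_Integration.integral_diff int integrable_mult_indicator) auto
      finally show ?thesis .
    qed
    moreover have "((\<lambda>x. (\<integral>t. ?w t \<partial>lborel) - (\<integral>t. indicator {..x} t *\<^sub>R ?w t \<partial>lborel)) \<longlongrightarrow>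
        (\<integral>t. ?w t \<partial>lborel) - (\<integral>t. ?w t \<partial>lborel)) at_top"
      by (intro tendsto_intros tendsto_integral_at_top int) simp
    ultimately show ?thesis by (simp add: MInf)
  qed (use rs in simp)
  have F_fun: "F = (\<lambda>x. poly q x * f x)" using F_eq by blast
  show ?thesis
  proof
    show "((\<lambda>x. poly q x * f x) \<longlongrightarrow> 0) (at_upper s)" using F_upper by (simp add: F_fun)
    show "((\<lambda>x. poly q (- x) * f (- x)) \<longlongrightarrow> 0) (at_upper (- r))" using F_lower by (simp add: F_fun)
    show "((\<lambda>x. poly q x * f x) has_real_derivative (?m - x) * f x) (at x)"
      if "x \<in> einterval r s" for x using F_deriv[OF that] by (simp add: F_fun)
    show "set_integrable lborel (einterval r s) (\<lambda>x. f x * x ^ n)" for n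
      using int_f unfolding set_integrable_def by (intro integrable_mult_indicator) auto
  qed (use rs degree q_pos E in auto)
qed

lemma density_variance_series:
  fixes f g :: "real \<Rightarrow> real" and q :: "real poly"
  assumes M: "prob_space M" and X [measurable]: "X \<in> borel_measurable M"
    and X_moments: "\<And>n :: nat. integrable M (\<lambda>\<omega>. X \<omega> ^ n)"
    and dense: "polynomials_dense_L2 (distr M borel X)"
    and degree: "degree q \<le> 2"
    and f_nonneg: "\<And>x. 0 \<le> f x"
    and dist: "distributed M lborel X (\<lambda>x. ennreal (f x))"
    and eq: "\<And>x. (LBINT t:{..x}. (prob_space.expectation M X - t) * f t) = poly q x * f x"
    and supp: "{x. 0 < f x} = einterval r s"
    and g: "in_L2 (distr M borel X) g"
    and smooth: "infinitely_differentiable_on g (einterval r s)"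
    and int: "\<And>k. integrable M (\<lambda>\<omega>. poly q (X \<omega>) ^ k * \<bar>deriv_on (einterval r s) k g (X \<omega>)\<bar>)"
  shows "(\<lambda>n. let k = Suc n in
           (prob_space.expectation M (\<lambda>\<omega>. poly q (X \<omega>) ^ k * deriv_on (einterval r s) k g (X \<omega>)))\<^sup>2
           / (fact k * prob_space.expectation M (\<lambda>\<omega>. poly q (X \<omega>) ^ k)
              * (\<Prod>j = k - 1..2 * k - 2. 1 - real j * coeff q 2)))
        sums prob_space.variance M (\<lambda>\<omega>. g (X \<omega>))"
proof -
  interpret prob_space M by fact
  interpret pearson f "expectation X" q r s
    by (rule pearson_of_density[OF M X X_moments f_nonneg dist eq supp degree])
  let ?E = "einterval r s"
  have f_0: "f x = 0" if "x \<notin> ?E" for x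
    using that f_nonneg[of x] supp by force
  have [measurable]: "g \<in> borel_measurable borel"
    using g by (simp add: in_L2_def)
  have poly_meas [measurable]: "(\<lambda>x. poly p x) \<in> borel_measurable borel" for p :: "real poly"
    by (intro borel_measurable_continuous_onI continuous_intros)
  define D where "D k = (deriv ^^ k) g" for k
  have D: "(D k has_real_derivative D (Suc k) x) (at x)" if "x \<in> ?E" for k x
    using smooth that by (simp add: infinitely_differentiable_on_def D_def DERIV_deriv_iff_real_differentiable)
  have D_cont: "continuous_on ?E (D k)" for k
    by (rule continuous_at_imp_continuous_on) (auto intro: DERIV_isCont[OF D])
  have deriv_on_eq: "deriv_on ?E k g x = indicator ?E x *\<^sub>R D k x" for k x
    by (simp add: deriv_on_def D_def)
  have [measurable]: "deriv_on ?E k g \<in> borel_measurable borel" for k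
    unfolding deriv_on_eq[abs_def] by (intro borel_measurable_continuous_on_indicator D_cont) simp
  have expectation_eq: "expectation (\<lambda>\<omega>. \<phi> (X \<omega>)) = (LBINT x:?E. f x * \<phi> x)"
    if "\<phi> \<in> borel_measurable borel" for \<phi>
  proof -
    have "expectation (\<lambda>\<omega>. \<phi> (X \<omega>)) = (\<integral>x. f x * \<phi> x \<partial>lborel)"
      using distributed_integral[OF dist, of \<phi>] f_nonneg that by simp
    also have "\<dots> = (LBINT x:?E. f x * \<phi> x)"
      unfolding set_lebesgue_integral_def
      by (rule Bochner_Integration.integral_cong) (auto simp: indicator_def f_0)
    finally show ?thesis .
  qed
  have int': "set_integrable lborel ?E (\<lambda>x. poly q x ^ k * f x * \<bar>D k x\<bar>)" for k
  proof -
    have "integrable lborel (\<lambda>x. f x * (poly q x ^ k * \<bar>deriv_on ?E k g x\<bar>))"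
      using distributed_integrable[OF dist, of "\<lambda>x. poly q x ^ k * \<bar>deriv_on ?E k g x\<bar>"] f_nonneg int
      by simp
    then show ?thesis
      unfolding set_integrable_def
      by (rule Bochner_Integration.integrable_cong[THEN iffD1, rotated -1])
         (auto simp: deriv_on_eq indicator_def)
  qed
  have e_pos: "expectation (\<lambda>\<omega>. poly q (X \<omega>) ^ k) > 0" for k
  proof -
    obtain a where a: "r < ereal a" "ereal a < s" using ereal_dense2[OF r_less_s] by auto
    then obtain b where b: "a < b" "ereal b < s" using ereal_dense2[of "ereal a" s] by auto
    have "0 < (\<integral>x. f x * poly q x ^ k \<partial>lborel)"
    proof (rule lborel_integral_pos[OF _ _ b(1)])
      show "integrable lborel (\<lambda>x. f x * poly q x ^ k)"
        using distributed_integrable[OF dist, of "\<lambda>x. poly (q ^ k) x"] f_nonneg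
          integrable_poly[OF X_moments, of "q ^ k"] by simp
      show "0 \<le> f x * poly q x ^ k" for x
        using q_pos[of x] f_pos[of x] f_0[of x] by (cases "x \<in> ?E") auto
      show "0 < f x * poly q x ^ k" if "a < x" "x < b" for x
      proof -
        have "x \<in> ?E" using a b that
          by (auto simp: einterval_iff intro: less_trans[of r "ereal a"] less_trans[of _ "ereal b"])
        then show ?thesis using q_pos f_pos by simp
      qed
    qed
    also have "\<dots> = expectation (\<lambda>\<omega>. poly q (X \<omega>) ^ k)"
      using distributed_integral[OF dist, of "\<lambda>x. poly q x ^ k"] f_nonneg by simp
    finally show ?thesis .
  qed
  show ?thesis
  proof (rule variance_series[OF M X X_moments dense _ lead_nonpos e_pos _ g])
    show "degree Q \<le> d \<Longrightarrow> degree (T l Q) \<le> Suc d \<and>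
      coeff (T l Q) (Suc d) = (1 - real (2 * l + d) * coeff q 2) * coeff Q d" for l Q d
      by (rule T_degree_coeff)
    show "expectation (\<lambda>\<omega>. poly (lower T k 1) (X \<omega>) * poly R (X \<omega>)) =
       fact k * expectation (\<lambda>\<omega>. poly q (X \<omega>) ^ k) * coeff R k" if "degree R \<le> k" for k R
    proof -
      have "expectation (\<lambda>\<omega>. poly (lower T k 1) (X \<omega>) * poly R (X \<omega>)) =
          (LBINT x:?E. f x * (poly (lower T k 1) x * poly R x))"
        by (rule expectation_eq) measurable
      moreover have "expectation (\<lambda>\<omega>. poly q (X \<omega>) ^ k) = (LBINT x:?E. f x * poly q x ^ k)"
        by (rule expectation_eq) measurable
      ultimately show ?thesis
        using rodrigues_orthogonal[OF that] by (simp only: mult_ac)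
    qed
    show "expectation (\<lambda>\<omega>. poly q (X \<omega>) ^ k * deriv_on ?E k g (X \<omega>)) =
       expectation (\<lambda>\<omega>. poly (lower T k 1) (X \<omega>) * g (X \<omega>))" for k
    proof -
      have "expectation (\<lambda>\<omega>. poly q (X \<omega>) ^ k * deriv_on ?E k g (X \<omega>))
          = (LBINT x:?E. f x * (poly q x ^ k * deriv_on ?E k g x))"
        by (rule expectation_eq) measurable
      also have "\<dots> = (LBINT x:?E. poly q x ^ k * f x * poly 1 x * D k x)"
        by (rule set_lebesgue_integral_cong) (auto simp: deriv_on_eq)
      also have "\<dots> = (LBINT x:?E. f x * poly (lower T k 1) x * D 0 x)"
        by (rule stein_rodrigues[OF D int'])
      also have "\<dots> = expectation (\<lambda>\<omega>. poly (lower T k 1) (X \<omega>) * g (X \<omega>))"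
        by (subst expectation_eq) (simp_all add: D_def mult.assoc)
      finally show ?thesis .
    qed
  qed
qed

section \<open>Discrete distributions of Pearson type\<close>

text \<open>The second coefficient is needed because the leading terms cancel, both in a difference
  R(x+1) - R(x) and in the discrete operator T, so the next order decides.\<close>

lemma coeff_pcompose_shift:
  fixes Q :: "real poly"
  assumes "degree Q \<le> d"
  shows "coeff (pcompose Q [:c, 1:]) d = coeff Q d"
    and "d = Suc e \<Longrightarrow> coeff (pcompose Q [:c, 1:]) e = coeff Q e + c * real d * coeff Q d"
    and "n > d \<Longrightarrow> coeff (pcompose Q [:c, 1:]) n = 0"
proof -
  show "n > d \<Longrightarrow> coeff (pcompose Q [:c, 1:]) n = 0" 
    using assms by (simp add: coeff_eq_0 degree_pcompose)
  have "coeff (pcompose Q [:c, 1:]) d = coeff Q d \<and>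
    (\<forall>e. d = Suc e \<longrightarrow> coeff (pcompose Q [:c, 1:]) e = coeff Q e + c * real d * coeff Q d)"
    using assms
  proof (induction Q arbitrary: d)
    case 0
    then show ?case by simp
  next
    case (pCons a P)
    show ?case
    proof (cases d)
      case 0
      then have "P = 0" using pCons.prems by (simp split: if_splits)
      then show ?thesis using 0 by (simp add: pcompose_pCons)
    next
      case (Suc e)
      then have P: "degree P \<le> e" using pCons.prems by (simp split: if_splits)
      then have "coeff (pcompose P [:c, 1:]) (Suc e) = 0" by (simp add: coeff_eq_0 degree_pcompose)
      then show ?thesis using pCons.IH[OF P] Suc
        by (cases e) (simp_all add: pcompose_pCons coeff_pCons algebra_simps)
    qed
  qed
  then show "coeff (pcompose Q [:c, 1:]) d = coeff Q d"
    and "d = Suc e \<Longrightarrow> coeff (pcompose Q [:c, 1:]) e = coeff Q e + c * real d * coeff Q d"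
    by blast+
qed

definition poly_diff_op :: "real poly \<Rightarrow> real poly" where
  "poly_diff_op R = pcompose R [:1, 1:] - R"

lemma poly_diff_op_power_eq_const:
  assumes "degree R \<le> k"
  shows "(poly_diff_op ^^ k) R = [:fact k * coeff R k:]"
  using assms
proof (induction k arbitrary: R)
  case 0
  then show ?case by (metis degree_0_id funpow_0 fact_0 le_zero_eq mult_1 )
next
  case (Suc k)
  have "coeff (poly_diff_op R) n = 0" if "n > k" for n
    using coeff_pcompose_shift(1,3)[OF Suc.prems, where c = 1] Suc.prems that
    by (cases "n = Suc k") (auto simp: poly_diff_op_def coeff_eq_0)
  then have "degree (poly_diff_op R) \<le> k" by (intro degree_le) auto
  moreover have "coeff (poly_diff_op R) k = real (Suc k) * coeff R (Suc k)"
    using coeff_pcompose_shift(2)[OF Suc.prems refl, of 1] by (simp add: poly_diff_op_def)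
  ultimately show ?case
    using Suc.IH[of "poly_diff_op R"] by (simp add: funpow_swap1 mult_ac)
qed

text \<open>The ascending power as a polynomial, which makes moments and measurability of
  polynomials available for it.\<close>

definition ascending_poly :: "real poly \<Rightarrow> nat \<Rightarrow> real poly" where
  "ascending_poly q k = (\<Prod>i<k. pcompose q [:real i, 1:])"

lemma poly_ascending_poly: "poly (ascending_poly q k) x = ascending_power (poly q) k x"
  by (simp add: ascending_poly_def ascending_power_def poly_prod poly_pcompose add.commute)

lemma ascending_power_Suc: "ascending_power q (Suc k) x = ascending_power q k x * q (x + real k)"
  by (simp add: ascending_power_def)

text \<open>Splitting off the first factor instead of the last one relates the weight of order i + 1
  at x to the weight of order i at x + 1; summation by parts uses both splittings.\<close>

lemma ascending_power_Suc_shift: "ascending_power q (Suc k) x = q x * ascending_power q k (x + 1)"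
  unfolding ascending_power_def prod.lessThan_Suc_shift by (simp add: add_ac)

section \<open>Summation by parts against a discrete Pearson weight\<close>

locale discrete_pearson =
  fixes p :: "nat \<Rightarrow> real" and m :: real and q :: "real poly"
  assumes degree_q: "degree q \<le> 2"
    and p_nonneg: "\<And>x. 0 \<le> p x"
    and cumulative: "\<And>x. (\<Sum>j = 0..x. (m - real j) * p j) = poly q (real x) * p x"
    and moments: "\<And>n. summable (\<lambda>x. p x * real x ^ n)"
    and p_sums: "p sums 1"
    and mean: "(\<lambda>x. p x * real x) sums m"
    and infinite_support: "infinite {x. 0 < p x}"
begin

definition a :: nat where "a = (LEAST x. 0 < p x)"

lemma p_a: "0 < p a"
  unfolding a_def by (rule LeastI_ex) (use infinite_support not_finite_existsD in blast)

lemma p_below: "x < a \<Longrightarrow> p x = 0"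
  using not_less_Least[of x "\<lambda>x. 0 < p x"] p_nonneg[of x] by (auto simp: a_def)

text \<open>Below the mean the partial sum has nonnegative terms and a positive one at j = a. From
  the mean on it equals minus the tail, which contains a later point of the infinite support. It
  follows that the support is {a, a+1, ...} and that q is positive on it.\<close>

lemma qp_pos:
  assumes "a \<le> x"
  shows "0 < poly q (real x) * p x"
proof (cases "real x < m")
  case True
  have "0 < (\<Sum>j = 0..x. (m - real j) * p j)"
    by (rule sum_pos2[where i = a])
       (use True assms p_a p_nonneg in \<open>auto intro!: mult_nonneg_nonneg\<close>)
  then show ?thesis by (simp add: cumulative)
next
  case False
  obtain y where y: "x < y" "0 < p y" 
    using infinite_support unfolding infinite_nat_iff_unbounded by blast
  have "(\<lambda>j. real j * p j - m * p j) sums (m - m * 1)"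
    using mean p_sums by (intro sums_diff sums_mult) (simp_all add: mult.commute)
  then have "(\<lambda>j. (real j - m) * p j) sums 0" by (simp add: algebra_simps)
  then have s: "(\<lambda>j. (real (j + Suc x) - m) * p (j + Suc x)) sums (0 - (\<Sum>j<Suc x. (real j - m) * p j))"
    by (rule sums_split_initial_segment)
  have "0 < (\<Sum>j. (real (j + Suc x) - m) * p (j + Suc x))"
  proof (rule suminf_pos2[where i = "y - Suc x"])
    show "0 \<le> (real (j + Suc x) - m) * p (j + Suc x)" for j
      using False p_nonneg by (intro mult_nonneg_nonneg) auto
    show "0 < (real (y - Suc x + Suc x) - m) * p (y - Suc x + Suc x)"
      using False y by simp
  qed (use s sums_summable in blast)
  also have "\<dots> = - (\<Sum>j<Suc x. (real j - m) * p j)"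
    using sums_unique[OF s] by simp
  also have "\<dots> = (\<Sum>j = 0..x. (m - real j) * p j)"
    unfolding sum_negf[symmetric] by (intro sum.cong) (auto simp: algebra_simps)
  finally show ?thesis by (simp only: cumulative)
qed

lemma q_pos: "a \<le> x \<Longrightarrow> 0 < poly q (real x)" and p_pos: "a \<le> x \<Longrightarrow> 0 < p x"
  using qp_pos[of x] p_nonneg[of x] by (auto simp: zero_less_mult_iff)

lemma cumulative_Suc:
  "poly q (real x) * p x = (poly q (real (Suc x)) - (m - real (Suc x))) * p (Suc x)"
  using cumulative[of x] cumulative[of "Suc x"] by (simp add: algebra_simps)

lemma cumulative_0: "(poly q 0 - m) * p 0 = 0"
  using cumulative[of 0] by auto

definition w :: "nat \<Rightarrow> nat \<Rightarrow> real" where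
  "w i x = ascending_power (poly q) i (real x) * p x"

lemma w_0 [simp]: "w 0 x = p x"
  by (simp add: w_def ascending_power_def)

lemma w_pos: "a \<le> x \<Longrightarrow> 0 < w i x"
  unfolding w_def ascending_power_def
  by (intro mult_pos_pos prod_pos p_pos) (use q_pos[of "x + _"] in simp_all)

lemma w_nonneg: "0 \<le> w i x"
  using w_pos[of x i] p_below[of x] by (cases "a \<le> x") (auto simp: w_def)

lemma w_Suc: "w (Suc i) x = w i x * poly q (real x + real i)"
  by (simp add: w_def ascending_power_Suc)

text \<open>Read off from the backward difference of \<open>w (Suc i) x * Q x\<close>. The
  last-factor splitting writes \<open>w (Suc i) x\<close> as w i x q(x+i); the first-factor
  splitting and the cumulative identity write its value at x - 1 as w i x (q(x) - (m - x)).\<close>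

definition T :: "nat \<Rightarrow> real poly \<Rightarrow> real poly" where
  "T i Q = (q - [:m, - 1:]) * pcompose Q [:- 1, 1:] - pcompose q [:real i, 1:] * Q"

lemma poly_T: "poly (T i Q) x = (poly q x - (m - x)) * poly Q (x - 1) - poly q (x + real i) * poly Q x"
  by (simp add: T_def poly_pcompose add.commute algebra_simps)

text \<open>Both products have the same coefficient at degree d + 2. At d + 1 the difference keeps 1
  from x, -2 i \<delta> from the shift of q by i and -d \<delta> from the shift of Q by -1.\<close>

lemma T_degree_coeff:
  assumes Q: "degree Q \<le> d"
  shows "degree (T i Q) \<le> Suc d \<and>
    coeff (T i Q) (Suc d) = (1 - real (2 * i + d) * coeff q 2) * coeff Q d"
proof -
  define a b c where abc: "a = coeff q 0" "b = coeff q 1" "c = coeff q 2"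
  have q: "q = [:a, b, c:]"
    unfolding abc by (rule quadratic_poly_eq[OF degree_q])
  define S where "S = pcompose Q [:- 1, 1:]"
  have "q - [:m, - 1:] = [:a - m, b + 1, c:]" unfolding q by simp
  moreover have "pcompose q [:real i, 1:] = [:a + i * b + i\<^sup>2 * c, b + 2 * i * c, c:]"
    unfolding q by (simp add: pcompose_pCons power2_eq_square algebra_simps)
  ultimately have T: "T i Q = [:a - m, b + 1, c:] * S - [:a + i * b + i\<^sup>2 * c, b + 2 * i * c, c:] * Q"
    by (simp only: T_def S_def)
  note S = coeff_pcompose_shift[OF Q, where c = "- 1", folded S_def]
  have "coeff (T i Q) n = 0" if "n > Suc d" for n
  proof -
    define k where "k = n - 2"
    have k: "n = Suc (Suc k)" "d \<le> k" using that by (simp_all add: k_def)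
    then have "coeff S k = coeff Q k"
      using S(1,3) Q by (cases "k = d") (auto simp: coeff_eq_0)
    then show ?thesis using k S(3) Q by (simp add: T coeff_eq_0)
  qed
  then have "degree (T i Q) \<le> Suc d" by (intro degree_le) auto
  moreover have "coeff (T i Q) (Suc d) = (1 - real (2 * i + d) * c) * coeff Q d"
  proof (cases d)
    case 0
    then show ?thesis using S(1) S(3)[of "Suc d"] Q by (simp add: T coeff_eq_0 algebra_simps)
  next
    case (Suc e)
    then have S_e: "coeff S e = coeff Q e - real (Suc e) * coeff Q (Suc e)"
      using S(2)[OF Suc] Suc by (simp add: algebra_simps)
    show ?thesis using S(1) S(3)[of "Suc d"] Q Suc
      by (simp add: T S_e coeff_eq_0 algebra_simps)
  qed
  ultimately show ?thesis by (simp add: abc)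
qed

lemma weight_diff:
  "w (Suc i) (Suc x) * poly Q (real (Suc x)) - w (Suc i) x * poly Q (real x)
    = - (w i (Suc x) * poly (T i Q) (real (Suc x)))"
proof -
  have "w (Suc i) x = ascending_power (poly q) i (real (Suc x)) * (poly q (real x) * p x)"
    by (simp add: w_def ascending_power_Suc_shift add.commute mult_ac)
  also have "\<dots> = w i (Suc x) * (poly q (real (Suc x)) - (m - real (Suc x)))"
    unfolding cumulative_Suc by (simp only: w_def mult_ac)
  finally have w_x: "w (Suc i) x = \<dots>" .
  show ?thesis
    unfolding w_x w_Suc[of i "Suc x"] poly_T by (simp add: algebra_simps)
qed

text \<open>The difference identity at x = 0 with the weight at -1 read as 0. The cumulative
  identity there says p(0) = 0 or q(0) = m, so summation by parts has no boundary term at the lower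
  end.\<close>

lemma weight_0: "w (Suc i) 0 * poly Q 0 = - (w i 0 * poly (T i Q) 0)"
proof (cases "p 0 = 0")
  case False
  then have "poly q 0 = m" using cumulative_0 by simp
  then show ?thesis by (simp add: w_Suc poly_T)
qed (simp add: w_def)

lemma summable_w: "summable (\<lambda>x. w i x * poly Q (real x))"
proof -
  have "summable (\<lambda>x. \<Sum>k\<le>degree R. coeff R k * (p x * real x ^ k))" for R
    by (intro summable_sum summable_mult moments)
  then have *: "summable (\<lambda>x. p x * poly R (real x))" for R
    by (simp add: poly_altdef sum_distrib_left mult_ac)
  show ?thesis using *[of "ascending_poly q i * Q"]
    by (simp add: poly_ascending_poly w_def mult_ac)
qed

lemma eventually_poly_T:
  assumes "degree Q \<le> d" "(1 - real (2 * i + d) * coeff q 2) * coeff Q d > 0"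
  obtains \<epsilon> where "\<epsilon> > 0" "\<forall>\<^sub>F x in sequentially. poly (T i Q) (real x) \<ge> \<epsilon> * (1 + real x) ^ Suc d"
proof -
  have "degree (T i Q) \<le> Suc d" "coeff (T i Q) (Suc d) > 0"
    using T_degree_coeff[OF assms(1), of i] assms(2) by auto
  then obtain \<epsilon> where \<epsilon>: "\<epsilon> > 0" "\<forall>\<^sub>F x in at_top. poly (T i Q) x \<ge> \<epsilon> * (1 + \<bar>x\<bar>) ^ Suc d"
    by (rule poly_ge_at_top)
  have "\<forall>\<^sub>F x in sequentially. poly (T i Q) (real x) \<ge> \<epsilon> * (1 + \<bar>real x\<bar>) ^ Suc d"
    using eventually_compose_filterlim[OF \<epsilon>(2) filterlim_real_sequentially] .
  then show ?thesis using that[OF \<epsilon>(1)] by simp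
qed

lemma lead_nonpos: "coeff q 2 \<le> 0"
proof (rule ccontr)
  assume pos: "\<not> coeff q 2 \<le> 0"
  then obtain i :: nat where "1 / coeff q 2 < real i" using reals_Archimedean2 by blast
  then have i: "1 < real i * coeff q 2" using pos by (simp add: field_simps)
  \<comment> \<open>The constant -1 is used for Q since only lower bounds are at hand: its leading
    factor -(1 - 2 i \<delta>) is positive as i \<delta> > 1.\<close>
  obtain \<epsilon> where \<epsilon>: "\<epsilon> > 0"
    "\<forall>\<^sub>F x in sequentially. poly (T i [:- 1:]) (real x) \<ge> \<epsilon> * (1 + real x) ^ Suc 0"
    by (rule eventually_poly_T[of "[:- 1:]" 0 i]) (use i in auto)
  then obtain N where N: "\<And>x. N \<le> x \<Longrightarrow> poly (T i [:- 1:]) (real x) \<ge> \<epsilon> * (1 + real x) ^ Suc 0"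
    by (auto simp: eventually_sequentially)
  define n where "n = max N a"
  have step: "w (Suc i) x \<le> w (Suc i) (Suc x)" if "n \<le> x" for x
  proof -
    have "0 \<le> \<epsilon> * (1 + real (Suc x)) ^ Suc 0" using \<epsilon>(1) by simp
    also have "\<dots> \<le> poly (T i [:- 1:]) (real (Suc x))" using that by (intro N) (simp add: n_def)
    finally have "0 \<le> w i (Suc x) * poly (T i [:- 1:]) (real (Suc x))"
      using w_nonneg by simp
    then show ?thesis using weight_diff[of i x "[:- 1:]"] by simp
  qed
  have "w (Suc i) n \<le> w (Suc i) x" if "n \<le> x" for x
    using that by (induction x rule: dec_induct) (auto intro: order_trans step)
  then have "\<forall>\<^sub>F x in sequentially. w (Suc i) n \<le> w (Suc i) x"
    by (auto simp: eventually_sequentially)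
  moreover have "w (Suc i) \<longlonglongrightarrow> 0"
    using summable_LIMSEQ_zero[OF summable_w[of "Suc i" 1]] by simp
  ultimately have "w (Suc i) n \<le> 0" by (intro tendsto_lowerbound) auto
  then show False using w_pos[of n "Suc i"] by (simp add: n_def)
qed

lemma summable_weighted:
  assumes sm: "summable (\<lambda>x. w i x * (1 + real x) ^ d * \<bar>k x\<bar>)" and "degree Q \<le> d"
  shows "summable (\<lambda>x. w i x * poly Q (real x) * k x)"
proof -
  obtain C where C: "C \<ge> 0" "\<And>x. \<bar>poly Q x\<bar> \<le> C * (1 + \<bar>x\<bar>) ^ d"
    using abs_poly_le[OF \<open>degree Q \<le> d\<close>] by blast
  show ?thesis
  proof (rule summable_comparison_test'[OF summable_mult[OF sm, of C]])
    fix x :: nat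
    have "norm (w i x * poly Q (real x) * k x) = w i x * \<bar>poly Q (real x)\<bar> * \<bar>k x\<bar>"
      using w_nonneg by (simp add: abs_mult)
    also have "\<dots> \<le> w i x * (C * (1 + \<bar>real x\<bar>) ^ d) * \<bar>k x\<bar>"
      by (intro mult_right_mono mult_left_mono C w_nonneg) auto
    finally show "norm (w i x * poly Q (real x) * k x) \<le> C * (w i x * (1 + real x) ^ d * \<bar>k x\<bar>)"
      by (simp add: mult_ac)
  qed
qed

text \<open>The discrete form of the end estimate, with the explicit weight (1 + x)^d: its image
  under T i has leading coefficient 1 - (2 i + d) \<delta> \<ge> 1, so W decreases at the rate of
  \<open>w i\<close> times (1 + x)^(d+1).\<close>

lemma summable_step:
  assumes sm: "summable (\<lambda>x. w (Suc i) x * (1 + real x) ^ d * \<bar>h (Suc x) - h x\<bar>)"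
  shows "summable (\<lambda>x. w i x * (1 + real x) ^ Suc d * \<bar>h x\<bar>)"
proof -
  have R: "degree ([:1, 1:] ^ d :: real poly) \<le> d" "coeff ([:1, 1:] ^ d :: real poly) d = 1"
    using degree_power_le[of "[:1, 1:] :: real poly" d] by (simp_all add: coeff_linear_poly_power)
  have "real (2 * i + d) * coeff q 2 \<le> 0" by (intro mult_nonneg_nonpos lead_nonpos) simp
  then obtain \<epsilon> where \<epsilon>: "\<epsilon> > 0"
    "\<forall>\<^sub>F x in sequentially. poly (T i ([:1, 1:] ^ d)) (real x) \<ge> \<epsilon> * (1 + real x) ^ Suc d"
    by (rule_tac eventually_poly_T[OF R(1), of i]) (simp_all add: R(2))
  then obtain N where N: "\<And>x. N \<le> x \<Longrightarrow> poly (T i ([:1, 1:] ^ d)) (real x) \<ge> \<epsilon> * (1 + real x) ^ Suc d"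
    by (auto simp: eventually_sequentially)
  define W where "W x = w (Suc i) x * (1 + real x) ^ d" for x
  define u where "u x = w i x * (1 + real x) ^ Suc d * \<bar>h x\<bar>" for x
  define H where "H n = \<bar>h N\<bar> + (\<Sum>k<n. \<bar>h (Suc (N + k)) - h (N + k)\<bar>)" for n
  have W_nonneg: "0 \<le> W x" for x using w_nonneg by (simp add: W_def)
  have h_le: "\<bar>h (N + n)\<bar> \<le> H n" for n
  proof (induction n)
    case (Suc n)
    then show ?case by (simp add: H_def)
  qed (simp add: H_def)
  have W_step: "\<epsilon> * (w i (Suc x) * (1 + real (Suc x)) ^ Suc d) \<le> W x - W (Suc x)" if "N \<le> x" for x
  proof -
    have "W (Suc x) - W x = - (w i (Suc x) * poly (T i ([:1, 1:] ^ d)) (real (Suc x)))"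
      using weight_diff[of i x "[:1, 1:] ^ d"] by (simp add: W_def)
    moreover have "w i (Suc x) * (\<epsilon> * (1 + real (Suc x)) ^ Suc d)
        \<le> w i (Suc x) * poly (T i ([:1, 1:] ^ d)) (real (Suc x))"
      using that by (intro mult_left_mono N w_nonneg) simp
    ultimately show ?thesis by (simp add: mult_ac)
  qed
  \<comment> \<open>H is the discrete majorant of |h|. In one step the loss (W(x) - W(x+1)) H(n+1)
    pays for \<epsilon> u(x+1), where x = N + n, and the growth of H costs W(x) |h(x+1) -
    h(x)|.\<close>
  have main: "\<epsilon> * (\<Sum>k<n. u (Suc (N + k))) + W (N + n) * H n
      \<le> W N * \<bar>h N\<bar> + (\<Sum>k<n. W (N + k) * \<bar>h (Suc (N + k)) - h (N + k)\<bar>)" for n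
  proof (induction n)
    case 0
    then show ?case by (simp add: H_def)
  next
    case (Suc n)
    have "\<epsilon> * u (Suc (N + n)) = \<epsilon> * (w i (Suc (N + n)) * (1 + real (Suc (N + n))) ^ Suc d) * \<bar>h (Suc (N + n))\<bar>"
      by (simp only: u_def mult.assoc)
    also have "\<dots> \<le> (W (N + n) - W (Suc (N + n))) * \<bar>h (Suc (N + n))\<bar>"
      by (intro mult_right_mono W_step) auto
    also have "\<dots> \<le> (W (N + n) - W (Suc (N + n))) * H (Suc n)"
    proof (intro mult_left_mono)
      show "\<bar>h (Suc (N + n))\<bar> \<le> H (Suc n)" using h_le[of "Suc n"] by simp
      have "0 \<le> \<epsilon> * (w i (Suc (N + n)) * (1 + real (Suc (N + n))) ^ Suc d)"
        using \<epsilon>(1) w_nonneg[of i "Suc (N + n)"] by simp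
      then show "0 \<le> W (N + n) - W (Suc (N + n))" using W_step[of "N + n"] by linarith
    qed
    finally have "\<epsilon> * u (Suc (N + n)) + W (Suc (N + n)) * H (Suc n) \<le> W (N + n) * H (Suc n)"
      by (simp add: algebra_simps)
    also have "\<dots> = W (N + n) * H n + W (N + n) * \<bar>h (Suc (N + n)) - h (N + n)\<bar>"
      by (simp add: H_def distrib_left)
    finally have "\<epsilon> * u (Suc (N + n)) + W (Suc (N + n)) * H (Suc n) \<le> \<dots>" .
    then show ?case using Suc.IH by (simp add: distrib_left)
  qed
  have smW: "summable (\<lambda>x. W x * \<bar>h (Suc x) - h x\<bar>)" using sm by (simp add: W_def)
  define B where "B = W N * \<bar>h N\<bar> + (\<Sum>x. W (N + x) * \<bar>h (Suc (N + x)) - h (N + x)\<bar>)"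
  have "(\<Sum>k<n. u (Suc (N + k))) \<le> B / \<epsilon>" for n
  proof -
    have "(\<Sum>k<n. W (N + k) * \<bar>h (Suc (N + k)) - h (N + k)\<bar>) \<le> (\<Sum>x. W (N + x) * \<bar>h (Suc (N + x)) - h (N + x)\<bar>)"
      using summable_ignore_initial_segment[OF smW, of N] W_nonneg
      by (intro sum_le_suminf) (auto simp: add.commute)
    moreover have "0 \<le> W (N + n) * H n" 
      using W_nonneg by (simp add: H_def sum_nonneg)
    ultimately have "\<epsilon> * (\<Sum>k<n. u (Suc (N + k))) \<le> B" using main[of n] by (simp add: B_def)
    then show ?thesis using \<epsilon>(1) by (simp add: field_simps)
  qed
  then have "(\<Sum>k\<le>n. u (Suc (N + k))) \<le> B / \<epsilon>" for n
    unfolding lessThan_Suc_atMost[symmetric] .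
  moreover have "0 \<le> u x" for x using w_nonneg by (simp add: u_def)
  ultimately have "summable (\<lambda>k. u (Suc (N + k)))" by (intro bounded_imp_summable)
  then have "summable u" using summable_iff_shift[of u "Suc N"] by (simp add: add.commute)
  then show ?thesis by (simp add: u_def[abs_def])
qed

text \<open>The spare degree in the hypothesis on \<open>Q\<close> makes the boundary term \<open>w (i+1) n Q(n) h(n)\<close> summable,
  as \<open>w (i+1)\<close> is \<open>w i\<close> times a quadratic polynomial.\<close>

lemma stein_step:
  assumes sm: "summable (\<lambda>x. w (Suc i) x * (1 + real x) ^ d * \<bar>h (Suc x) - h x\<bar>)"
    and Q: "Suc (degree Q) \<le> d"
  shows "(\<Sum>x. w (Suc i) x * poly Q (real x) * (h (Suc x) - h x)) =
    (\<Sum>x. w i x * poly (T i Q) (real x) * h x)"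
proof -
  define W where "W x = w (Suc i) x * poly Q (real x)" for x
  define V where "V x = w i x * poly (T i Q) (real x)" for x
  have sm': "summable (\<lambda>x. w i x * (1 + real x) ^ Suc d * \<bar>h x\<bar>)"
    by (rule summable_step[OF sm])
  have sW: "summable (\<lambda>x. W x * (h (Suc x) - h x))"
    unfolding W_def by (rule summable_weighted[OF sm]) (use Q in simp)
  have sV: "summable (\<lambda>x. V x * h x)"
    unfolding V_def by (rule summable_weighted[OF sm']) (use T_degree_coeff[of Q d i] Q in simp)
  have "degree (pcompose q [:real i, 1:] * Q) \<le> Suc d"
    using degree_mult_le[of "pcompose q [:real i, 1:]" Q] degree_q Q by (simp add: degree_pcompose)
  from summable_weighted[OF sm' this] have sWh: "summable (\<lambda>x. W x * h x)"
    by (simp add: W_def w_Suc poly_pcompose mult_ac add.commute)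
  have W_Suc: "W x = W (Suc x) + V (Suc x)" for x
    using weight_diff[of i x Q] by (simp add: W_def V_def)
  \<comment> \<open>Abel summation with W(x) = W(x+1) + V(x+1); the start needs W(0) = -V(0), which
    is \<open>weight_0\<close>.\<close>
  have partial: "(\<Sum>x<Suc n. W x * (h (Suc x) - h x)) = W n * h (Suc n) + (\<Sum>x<Suc n. V x * h x)" for n
  proof (induction n)
    case 0
    then show ?case using weight_0[of i Q] by (simp add: W_def V_def algebra_simps)
  next
    case (Suc n)
    have "(\<Sum>x<Suc (Suc n). W x * (h (Suc x) - h x))
      = W n * h (Suc n) + (\<Sum>x<Suc n. V x * h x) + W (Suc n) * (h (Suc (Suc n)) - h (Suc n))"
      using Suc.IH by simp
    then show ?case using W_Suc[of n] by (simp add: algebra_simps)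
  qed
  \<comment> \<open>The boundary term W(n) h(n+1) mixes two indices; rewritten as (W + V) h at n +
    1, it is a sum of general terms of two convergent series.\<close>
  have "(\<lambda>n. W (Suc n) * h (Suc n) + V (Suc n) * h (Suc n)) \<longlonglongrightarrow> 0 + 0"
    by (intro tendsto_add LIMSEQ_Suc summable_LIMSEQ_zero sWh sV)
  moreover have "W (Suc n) * h (Suc n) + V (Suc n) * h (Suc n) = W n * h (Suc n)" for n
    using W_Suc[of n] by (simp add: distrib_right)
  ultimately have "(\<lambda>n. W n * h (Suc n)) \<longlonglongrightarrow> 0" by simp
  moreover have "(\<lambda>n. \<Sum>x<Suc n. V x * h x) \<longlonglongrightarrow> (\<Sum>x. V x * h x)"
    using summable_LIMSEQ[OF sV] by (rule LIMSEQ_Suc)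
  ultimately have "(\<lambda>n. \<Sum>x<Suc n. W x * (h (Suc x) - h x)) \<longlonglongrightarrow> 0 + (\<Sum>x. V x * h x)"
    unfolding partial by (rule tendsto_add)
  moreover have "(\<lambda>n. \<Sum>x<Suc n. W x * (h (Suc x) - h x)) \<longlonglongrightarrow> (\<Sum>x. W x * (h (Suc x) - h x))"
    using summable_LIMSEQ[OF sW] by (rule LIMSEQ_Suc)
  ultimately have "(\<Sum>x. W x * (h (Suc x) - h x)) = (\<Sum>x. V x * h x)"
    using LIMSEQ_unique by fastforce
  then show ?thesis by (simp add: W_def V_def)
qed

lemma stein_rodrigues:
  assumes D: "\<And>k x. D (Suc k) x = D k (Suc x) - D k x"
    and sm: "\<And>k. summable (\<lambda>x. w k x * \<bar>D k x\<bar>)"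
  shows "(\<Sum>x. w k x * poly Q (real x) * D k x) = (\<Sum>x. p x * poly (lower T k Q) (real x) * D 0 x)"
proof -
  \<comment> \<open>Power d at order i descends from order i + d, as for densities. Having every d
    available also supplies the spare degree that the summation by parts demands.\<close>
  have sm': "summable (\<lambda>x. w i x * (1 + real x) ^ d * \<bar>D i x\<bar>)" for i d
  proof (induction d arbitrary: i)
    case 0
    then show ?case using sm by simp
  next
    case (Suc d)
    show ?case by (rule summable_step) (use Suc.IH[of "Suc i"] in \<open>simp add: D\<close>)
  qed
  show ?thesis
  proof (induction k arbitrary: Q)
    case 0
    then show ?case by simp
  next
    case (Suc k)
    have "(\<Sum>x. w (Suc k) x * poly Q (real x) * (D k (Suc x) - D k x)) =
        (\<Sum>x. w k x * poly (T k Q) (real x) * D k x)"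
      by (rule stein_step[OF _ order_refl]) (use sm'[of "Suc k" "Suc (degree Q)"] in \<open>simp add: D\<close>)
    then show ?case using Suc.IH[of "T k Q"] by (simp add: D)
  qed
qed

lemma rodrigues_orthogonal:
  assumes "degree R \<le> k"
  shows "(\<Sum>x. p x * poly (lower T k 1) (real x) * poly R (real x)) =
    fact k * (\<Sum>x. w k x) * coeff R k"
proof -
  have "(\<Sum>x. w k x * poly 1 (real x) * poly ((poly_diff_op ^^ k) R) (real x)) =
    (\<Sum>x. p x * poly (lower T k 1) (real x) * poly ((poly_diff_op ^^ 0) R) (real x))"
  proof (rule stein_rodrigues[where D = "\<lambda>k x. poly ((poly_diff_op ^^ k) R) (real x)"])
    show "poly ((poly_diff_op ^^ Suc k) R) (real x) =
      poly ((poly_diff_op ^^ k) R) (real (Suc x)) - poly ((poly_diff_op ^^ k) R) (real x)" for k x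
      by (simp add: poly_diff_op_def poly_pcompose)
    show "summable (\<lambda>x. w k x * \<bar>poly ((poly_diff_op ^^ k) R) (real x)\<bar>)" for k
    proof -
      let ?P = "(poly_diff_op ^^ k) R"
      obtain C where C: "C \<ge> 0" "\<And>x. \<bar>poly ?P x\<bar> \<le> C * (1 + \<bar>x\<bar>) ^ degree ?P"
        using abs_poly_le[OF order_refl] by blast
      show ?thesis
      proof (rule summable_comparison_test'[OF summable_w[of k "smult C ([:1, 1:] ^ degree ?P)"]])
        fix x :: nat
        show "norm (w k x * \<bar>poly ?P (real x)\<bar>) \<le> w k x * poly (smult C ([:1, 1:] ^ degree ?P)) (real x)"
          using C(2)[of "real x"] w_nonneg[of k x] by (simp add: abs_mult mult_left_mono)
      qed
    qed
  qed
  then have "(\<Sum>x. p x * poly (lower T k 1) (real x) * poly R (real x)) =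
      (\<Sum>x. fact k * coeff R k * w k x)"
    by (simp add: poly_diff_op_power_eq_const[OF assms] mult_ac)
  also have "\<dots> = fact k * coeff R k * (\<Sum>x. w k x)"
    using summable_w[of k 1] by (intro suminf_mult) simp
  finally show ?thesis by (simp add: mult_ac)
qed

end

section \<open>From a probability function on the naturals to the expansion in part (b)\<close>

lemma nat_valued_integral:
  fixes M :: "'a measure" and X :: "'a \<Rightarrow> real" and \<phi> :: "real \<Rightarrow> real"
  assumes "prob_space M" and [measurable]: "X \<in> borel_measurable M"
    and nat: "AE \<omega> in M. X \<omega> \<in> \<nat>"
    and p: "\<And>x. p x = measure M {\<omega> \<in> space M. X \<omega> = real x}"
    and [measurable]: "\<phi> \<in> borel_measurable borel"
  shows "integrable M (\<lambda>\<omega>. \<phi> (X \<omega>)) \<longleftrightarrow> summable (\<lambda>x. \<bar>p x * \<phi> (real x)\<bar>)"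
    and "integrable M (\<lambda>\<omega>. \<phi> (X \<omega>)) \<Longrightarrow>
      (\<lambda>x. p x * \<phi> (real x)) sums (\<integral>\<omega>. \<phi> (X \<omega>) \<partial>M)"
proof -
  interpret prob_space M by fact
  \<comment> \<open>X is natural-valued only almost surely; rounding gives a version that is so
    everywhere and whose law has density p with respect to counting measure.\<close>
  define Y where "Y \<omega> = nat \<lfloor>X \<omega>\<rfloor>" for \<omega>
  have [measurable]: "Y \<in> measurable M (count_space UNIV)" unfolding Y_def by measurable
  have XY: "AE \<omega> in M. X \<omega> = real (Y \<omega>)"
    using nat by eventually_elim (auto simp: Y_def elim!: Nats_cases)
  have distr: "distr M (count_space UNIV) Y = density (count_space UNIV) (\<lambda>x. ennreal (p x))"
  proof (rule measure_eqI_countable[where A = UNIV])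
    fix x :: nat
    have "emeasure (distr M (count_space UNIV) Y) {x} = emeasure M {\<omega> \<in> space M. Y \<omega> = x}"
      by (subst emeasure_distr) (auto intro!: arg_cong[where f = "emeasure M"])
    also have "\<dots> = emeasure M {\<omega> \<in> space M. X \<omega> = real x}"
      by (rule emeasure_eq_AE) (use XY in \<open>auto elim!: eventually_mono\<close>)
    also have "\<dots> = emeasure (density (count_space UNIV) (\<lambda>x. ennreal (p x))) {x}"
      by (simp add: emeasure_density p emeasure_eq_measure nn_integral_count_space_indicator[symmetric]
          nn_integral_count_space_finite)
    finally show "emeasure (distr M (count_space UNIV) Y) {x}
      = emeasure (density (count_space UNIV) (\<lambda>x. ennreal (p x))) {x}" .
  qed auto
  have p_nonneg: "0 \<le> p x" for x by (simp add: p)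
  have iXY: "integrable M (\<lambda>\<omega>. \<phi> (X \<omega>)) \<longleftrightarrow> integrable M (\<lambda>\<omega>. \<phi> (real (Y \<omega>)))"
    by (rule integrable_cong_AE) (use XY in \<open>auto elim!: eventually_mono\<close>)
  also have "\<dots> \<longleftrightarrow> integrable (distr M (count_space UNIV) Y) (\<lambda>x. \<phi> (real x))"
    by (simp add: integrable_distr_eq)
  also have "\<dots> \<longleftrightarrow> integrable (count_space UNIV) (\<lambda>x. p x * \<phi> (real x))"
    unfolding distr by (simp add: integrable_real_density p_nonneg)
  finally have iff: "integrable M (\<lambda>\<omega>. \<phi> (X \<omega>)) \<longleftrightarrow> integrable (count_space UNIV) (\<lambda>x. p x * \<phi> (real x))" .
  then show "integrable M (\<lambda>\<omega>. \<phi> (X \<omega>)) \<longleftrightarrow> summable (\<lambda>x. \<bar>p x * \<phi> (real x)\<bar>)"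
    by (simp add: integrable_count_space_nat_iff)
  assume int: "integrable M (\<lambda>\<omega>. \<phi> (X \<omega>))"
  have "(\<integral>\<omega>. \<phi> (X \<omega>) \<partial>M) = (\<integral>\<omega>. \<phi> (real (Y \<omega>)) \<partial>M)"
    by (rule integral_cong_AE) (use XY in \<open>auto elim!: eventually_mono\<close>)
  also have "\<dots> = (\<integral>x. \<phi> (real x) \<partial>distr M (count_space UNIV) Y)"
    by (simp add: integral_distr)
  also have "\<dots> = (\<integral>x. p x * \<phi> (real x) \<partial>count_space UNIV)"
    unfolding distr by (simp add: integral_real_density p_nonneg)
  finally show "(\<lambda>x. p x * \<phi> (real x)) sums (\<integral>\<omega>. \<phi> (X \<omega>) \<partial>M)"
    using sums_integral_count_space_nat[of "\<lambda>x. p x * \<phi> (real x)"] int iff by simp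
qed

lemma discrete_pearson_of_pmf:
  fixes M :: "'a measure" and X :: "'a \<Rightarrow> real" and q :: "real poly"
  assumes M: "prob_space M" and X [measurable]: "X \<in> borel_measurable M"
    and X_moments: "\<And>n :: nat. integrable M (\<lambda>\<omega>. X \<omega> ^ n)"
    and degree: "degree q \<le> 2"
    and nat: "AE \<omega> in M. X \<omega> \<in> \<nat>"
    and p: "\<And>x. p x = measure M {\<omega> \<in> space M. X \<omega> = real x}"
    and eq: "\<And>x. (\<Sum>j = 0..x. (prob_space.expectation M X - real j) * p j) = poly q (real x) * p x"
    and inf: "\<nexists>a b :: int. measure (distr M borel X) (real_of_int ` {a..b}) = 1"
  shows "discrete_pearson p (prob_space.expectation M X) q"
proof
  interpret prob_space M by fact
  note sums = nat_valued_integral[OF M X nat p]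
  show p_nonneg: "0 \<le> p x" for x by (simp add: p)
  show "summable (\<lambda>x. p x * real x ^ n)" for n
    by (rule sums_summable[OF sums(2)[where \<phi> = "\<lambda>x. x ^ n"]]) (simp_all add: X_moments)
  have "(\<lambda>x. p x * 1) sums (\<integral>\<omega>. 1 \<partial>M)"
    by (rule sums(2)) simp_all
  then show "p sums 1" by (simp add: prob_space)
  show "(\<lambda>x. p x * real x) sums expectation X"
    by (rule sums(2)[where \<phi> = "\<lambda>x. x"]) (use X_moments[of 1] in simp_all)
  show "infinite {x. 0 < p x}"
  proof
    assume "finite {x. 0 < p x}"
    then obtain N where N: "\<And>x. 0 < p x \<Longrightarrow> x \<le> N"
      using finite_nat_set_iff_bounded_le by auto
    \<comment> \<open>A finite support would lie in this interval; the mean of the indicator of its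
      complement is then a series of zeros, so the interval would have probability 1.\<close>
    let ?I = "real_of_int ` {0..int N}"
    have I: "?I \<in> sets borel" by (rule sets.countable) auto
    have "(\<lambda>x. p x * indicat_real (- ?I) (real x)) sums (\<integral>\<omega>. indicat_real (- ?I) (X \<omega>) \<partial>M)"
    proof (rule sums(2))
      show "integrable M (\<lambda>\<omega>. indicat_real (- ?I) (X \<omega>) :: real)"
        using I by (intro integrable_const_bound[where B = 1]) (auto simp: indicator_def)
    qed (use I in measurable)
    moreover have "p x * indicat_real (- ?I) (real x) = 0" for x
    proof (cases "0 < p x")
      case True
      then have "real x \<in> ?I" using N[of x] by (auto intro!: image_eqI[of _ _ "int x"])
      then show ?thesis by simp
    next
      case False
      then show ?thesis using p_nonneg[of x] by simp
    qed
    ultimately have "(\<integral>\<omega>. indicat_real (- ?I) (X \<omega>) \<partial>M) = (0::real)"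
      by (simp add: sums_iff)
    also have "(\<integral>\<omega>. indicat_real (- ?I) (X \<omega>) \<partial>M) = (\<integral>x. indicat_real (- ?I) x \<partial>distr M borel X)"
      by (rule integral_distr[OF X, symmetric]) (use I in auto)
    also have "\<dots> = measure (distr M borel X) (- ?I)" by simp
    also have "\<dots> = 1 - measure (distr M borel X) ?I"
      using prob_space.prob_compl[OF prob_space_distr[OF X], of ?I] I by (simp add: Compl_eq_Diff_UNIV)
    finally show False using inf by auto
  qed
qed (fact degree eq)+

lemma pmf_variance_series:
  fixes M :: "'a measure" and X :: "'a \<Rightarrow> real" and g :: "real \<Rightarrow> real" and q :: "real poly"
  assumes M: "prob_space M" and X [measurable]: "X \<in> borel_measurable M"
    and X_moments: "\<And>n :: nat. integrable M (\<lambda>\<omega>. X \<omega> ^ n)"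
    and dense: "polynomials_dense_L2 (distr M borel X)"
    and degree: "degree q \<le> 2"
    and nat: "AE \<omega> in M. X \<omega> \<in> \<nat>"
    and p: "\<And>x. p x = measure M {\<omega> \<in> space M. X \<omega> = real x}"
    and eq: "\<And>x. (\<Sum>j = 0..x. (prob_space.expectation M X - real j) * p j) = poly q (real x) * p x"
    and inf: "\<nexists>a b :: int. measure (distr M borel X) (real_of_int ` {a..b}) = 1"
    and g: "in_L2 (distr M borel X) g"
    and int: "\<And>k. integrable M
      (\<lambda>\<omega>. ascending_power (poly q) k (X \<omega>) * \<bar>(forward_diff ^^ k) g (X \<omega>)\<bar>)"
  shows "(\<lambda>n. let k = Suc n in
           (prob_space.expectation M
              (\<lambda>\<omega>. ascending_power (poly q) k (X \<omega>) * (forward_diff ^^ k) g (X \<omega>)))\<^sup>2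
           / (fact k * prob_space.expectation M (\<lambda>\<omega>. ascending_power (poly q) k (X \<omega>))
              * (\<Prod>j = k - 1..2 * k - 2. 1 - real j * coeff q 2)))
        sums prob_space.variance M (\<lambda>\<omega>. g (X \<omega>))"
proof -
  interpret prob_space M by fact
  interpret discrete_pearson p "expectation X" q
    by (rule discrete_pearson_of_pmf[OF M X X_moments degree nat p eq inf])
  note sums = nat_valued_integral[OF M X nat p]
  have [measurable]: "g \<in> borel_measurable borel"
    using g by (simp add: in_L2_def)
  have [measurable]: "(\<lambda>x. poly r x) \<in> borel_measurable borel" for r :: "real poly"
    by (intro borel_measurable_continuous_onI continuous_intros)
  have [measurable]: "ascending_power (poly q) k \<in> borel_measurable borel" for k
    unfolding poly_ascending_poly[symmetric, abs_def] by measurable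
  have g_diff [measurable]: "(forward_diff ^^ k) g \<in> borel_measurable borel" for k
    by (induction k) (simp_all add: forward_diff_def[abs_def])
  have int': "integrable M (\<lambda>\<omega>. ascending_power (poly q) k (X \<omega>) * (forward_diff ^^ k) g (X \<omega>))"
    and w_summable: "summable (\<lambda>x. w k x * \<bar>(forward_diff ^^ k) g (real x)\<bar>)" for k
  proof -
    have "integrable M (\<lambda>\<omega>. norm (ascending_power (poly q) k (X \<omega>) * \<bar>(forward_diff ^^ k) g (X \<omega>)\<bar>))"
      by (intro Bochner_Integration.integrable_norm int)
    then show "integrable M (\<lambda>\<omega>. ascending_power (poly q) k (X \<omega>) * (forward_diff ^^ k) g (X \<omega>))"
      by (subst integrable_norm_iff[symmetric]) (auto simp: abs_mult)
    have "summable (\<lambda>x. p x * (ascending_power (poly q) k (real x) * \<bar>(forward_diff ^^ k) g (real x)\<bar>))"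
      by (rule sums_summable[OF sums(2)[where \<phi> = "\<lambda>x. ascending_power (poly q) k x * \<bar>(forward_diff ^^ k) g x\<bar>"]])
         (simp_all add: int)
    then show "summable (\<lambda>x. w k x * \<bar>(forward_diff ^^ k) g (real x)\<bar>)"
      by (simp add: w_def mult_ac)
  qed
  have e_eq: "(\<integral>\<omega>. ascending_power (poly q) k (X \<omega>) \<partial>M) = (\<Sum>x. w k x)" for k
    using sums_unique[OF sums(2)[of "ascending_power (poly q) k"]]
      integrable_poly[OF X_moments, of "ascending_poly q k"]
    by (simp add: poly_ascending_poly w_def mult.commute)
  have e_pos: "(\<integral>\<omega>. ascending_power (poly q) k (X \<omega>) \<partial>M) > 0" for k
    unfolding e_eq using summable_w[of k 1] w_pos[OF order_refl, of k] w_nonneg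
    by (intro suminf_pos2[of _ a]) auto
  show ?thesis
  proof (rule variance_series[OF M X X_moments dense _ lead_nonpos e_pos _ g])
    show "degree Q \<le> d \<Longrightarrow> degree (T l Q) \<le> Suc d \<and>
      coeff (T l Q) (Suc d) = (1 - real (2 * l + d) * coeff q 2) * coeff Q d" for l Q d
      by (rule T_degree_coeff)
    show "expectation (\<lambda>\<omega>. poly (lower T k 1) (X \<omega>) * poly R (X \<omega>)) =
       fact k * expectation (\<lambda>\<omega>. ascending_power (poly q) k (X \<omega>)) * coeff R k"
      if "degree R \<le> k" for k R
    proof -
      have "(\<lambda>x. p x * (poly (lower T k 1) (real x) * poly R (real x))) sums
          expectation (\<lambda>\<omega>. poly (lower T k 1) (X \<omega>) * poly R (X \<omega>))"
        using sums(2)[of "\<lambda>x. poly (lower T k 1) x * poly R x"]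
          integrable_poly[OF X_moments, of "lower T k 1 * R"] by simp
      then show ?thesis
        using rodrigues_orthogonal[OF that] by (simp add: e_eq sums_iff mult.assoc)
    qed
    show "expectation (\<lambda>\<omega>. ascending_power (poly q) k (X \<omega>) * (forward_diff ^^ k) g (X \<omega>)) =
       expectation (\<lambda>\<omega>. poly (lower T k 1) (X \<omega>) * g (X \<omega>))" for k
    proof -
      have gX: "integrable M (\<lambda>\<omega>. poly (lower T k 1) (X \<omega>) * g (X \<omega>))"
      proof (rule integrable_mult_L2)
        show "integrable M (\<lambda>\<omega>. (g (X \<omega>))\<^sup>2)" using g by (simp add: in_L2_def integrable_distr_eq)
        show "integrable M (\<lambda>\<omega>. (poly (lower T k 1) (X \<omega>))\<^sup>2)"
          using integrable_poly[OF X_moments, of "(lower T k 1)\<^sup>2"] by simp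
      qed measurable
      have "(\<Sum>x. w k x * poly 1 (real x) * (forward_diff ^^ k) g (real x)) =
          (\<Sum>x. p x * poly (lower T k 1) (real x) * (forward_diff ^^ 0) g (real x))"
      proof (rule stein_rodrigues[where D = "\<lambda>k x. (forward_diff ^^ k) g (real x)"])
        show "(forward_diff ^^ Suc k) g (real x) =
          (forward_diff ^^ k) g (real (Suc x)) - (forward_diff ^^ k) g (real x)" for k x
          by (simp add: forward_diff_def add.commute)
      qed (rule w_summable)
      then show ?thesis
        using sums_unique[OF sums(2)[OF _ int', of k]] sums_unique[OF sums(2)[OF _ gX]]
        by (simp add: w_def mult_ac)
    qed
  qed
qed

section \<open>The variance expansion\<close>

theorem theorem5p1:
  fixes M :: "'a measure" and X :: "'a \<Rightarrow> real" and \<mu> :: "real measure"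
    and \<delta> \<beta> \<gamma> :: real and q :: "real \<Rightarrow> real"
  assumes "prob_space M"
    and "X \<in> borel_measurable M"
    and "\<mu> = distr M borel X"
    and "\<And>n :: nat. integrable M (\<lambda>\<omega>. X \<omega> ^ n)"
    and "polynomials_dense_L2 \<mu>"
    and "q = (\<lambda>x. \<delta> * x\<^sup>2 + \<beta> * x + \<gamma>)"
  shows
    "(\<forall>(f :: real \<Rightarrow> real) (r :: ereal) (s :: ereal) (g :: real \<Rightarrow> real).
        (\<forall>x. 0 \<le> f x) \<longrightarrow>
        distributed M lborel X (\<lambda>x. ennreal (f x)) \<longrightarrow>
        (\<forall>x. (LBINT t:{..x}. (prob_space.expectation M X - t) * f t) = q x * f x) \<longrightarrow>
        {x. 0 < f x} = einterval r s \<longrightarrow>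
        in_L2 \<mu> g \<longrightarrow>
        infinitely_differentiable_on g (einterval r s) \<longrightarrow>
        (\<forall>k. integrable M (\<lambda>\<omega>. q (X \<omega>) ^ k * \<bar>deriv_on (einterval r s) k g (X \<omega>)\<bar>)) \<longrightarrow>
        (\<lambda>n. let k = Suc n in
           (prob_space.expectation M (\<lambda>\<omega>. q (X \<omega>) ^ k * deriv_on (einterval r s) k g (X \<omega>)))\<^sup>2
           / (fact k * prob_space.expectation M (\<lambda>\<omega>. q (X \<omega>) ^ k)
              * (\<Prod>j = k - 1..2 * k - 2. 1 - real j * \<delta>)))
        sums prob_space.variance M (\<lambda>\<omega>. g (X \<omega>)))
     \<and>
     (\<forall>(p :: nat \<Rightarrow> real) (g :: real \<Rightarrow> real).
        (AE \<omega> in M. X \<omega> \<in> \<nat>) \<longrightarrow>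
        (\<forall>x. p x = measure M {\<omega> \<in> space M. X \<omega> = real x}) \<longrightarrow>
        (\<forall>x. (\<Sum>j = 0..x. (prob_space.expectation M X - real j) * p j) = q (real x) * p x) \<longrightarrow>
        (\<nexists>a b :: int. measure \<mu> (real_of_int ` {a..b}) = 1) \<longrightarrow>
        in_L2 \<mu> g \<longrightarrow>
        (\<forall>k. integrable M
           (\<lambda>\<omega>. ascending_power q k (X \<omega>) * \<bar>(forward_diff ^^ k) g (X \<omega>)\<bar>)) \<longrightarrow>
        (\<lambda>n. let k = Suc n in
           (prob_space.expectation M
              (\<lambda>\<omega>. ascending_power q k (X \<omega>) * (forward_diff ^^ k) g (X \<omega>)))\<^sup>2
           / (fact k * prob_space.expectation M (\<lambda>\<omega>. ascending_power q k (X \<omega>))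
              * (\<Prod>j = k - 1..2 * k - 2. 1 - real j * \<delta>)))
        sums prob_space.variance M (\<lambda>\<omega>. g (X \<omega>)))"
proof -
  let ?q = "[:\<gamma>, \<beta>, \<delta>:]"
  have q: "q = poly ?q"
    using assms(6) by (auto simp: fun_eq_iff power2_eq_square algebra_simps)
  have degree: "degree ?q \<le> 2" and lead: "coeff ?q 2 = \<delta>"
    by (simp_all add: eval_nat_numeral)
  note moments = assms(4) and dense = assms(5)[unfolded assms(3)]
  show ?thesis
    unfolding q assms(3)
  proof (intro conjI allI impI, goal_cases)
    case (1 f r s g)
    show ?case
      by (rule density_variance_series[OF assms(1,2) moments dense degree, of f, unfolded lead])
         (use 1 in blast)+
  next
    case (2 p g)
    show ?case
      by (rule pmf_variance_series[OF assms(1,2) moments dense degree, of p, unfolded lead])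
         (use 2 in blast)+
  qed
qed

end
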